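(* There are absolute constants $\epsilon_0>0$ and $c>0$ such that for all integers $k\ge2$, $n\ge1$ and all $0<\epsilon<\epsilon_0$, the class $\mathcal{T}_{n,k}$ of decision trees with at most $k$ nodes over $[0,1]^n$ satisfies $$m^{\mathrm{test}}_\epsilon(\mathcal{T}_{n,k})\ge c\cdot\frac{k}{\log k}\qquad\text{and}\qquad q^{\mathrm{test}}_{0,\epsilon}(\mathcal{T}_{n,k})\ge c\cdot\frac{k}{\log k}.$$
   Context: $\mathcal{T}_{n,k}$ is the set of functions $f:[0,1]^n\to\{0,1\}$ computed by (binary) decision trees with at most $k$ (internal) nodes, where each node is a test of the form "$x_i<t$?" for some $i\in\{1,\dots,n\}$ and $t\in\mathbb{R}$, and each leaf is labelled $0$ or $1$. For a class $\mathcal{H}$ of functions $\mathcal{X}\to\{0,1\}$ and a probability distribution $\mathcal{D}$ on $\mathcal{X}$, $\mathrm{dist}_{\mathcal{D}}(f,g)=\Pr_{x\sim\mathcal{D}}[f(x)\ne g(x)]$ and $\mathrm{dist}_{\mathcal{D}}(f,\mathcal{H})=\inf_{h\in\mathcal{H}}\mathrm{dist}_{\mathcal{D}}(f,h)$. All testers are computationally unbounded randomized algorithms that must work for every unknown distribution $\mathcal{D}$ (all finitely supported distributions are allowed) and every unknown $f:\mathcal{X}\to\{0,1\}$. (i) $m^{\mathrm{test}}_\epsilon(\mathcal{H})$ is the minimum $m$ such that some algorithm receiving $m$ labelled examples $(x,f(x))$, $x\sim\mathcal{D}$ independently, accepts with probability $\ge 2/3$ if $f\in\mathcal{H}$ and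 rejects with probability $\ge2/3$ if $\mathrm{dist}_{\mathcal{D}}(f,\mathcal{H})\ge\epsilon$. (ii) $q^{\mathrm{test}}_{0,\epsilon}(\mathcal{H})$ is the minimum $q$ such that some algorithm making in total at most $q$ adaptive queries to $f$ at arbitrary points of $\mathcal{X}$ and independent labelled samples $(x,f(x))$, $x\sim\mathcal{D}$, accepts with probability $\ge2/3$ if $\mathrm{dist}_{\mathcal{D}}(f,\mathcal{H})=0$ and rejects with probability $\ge2/3$ if $\mathrm{dist}_{\mathcal{D}}(f,\mathcal{H})\ge\epsilon$. *)

theory Defs
  imports "HOL-Probability.Probability"
begin

section \<open>Decision trees over the cube\<close>

text \<open>The dimension \<open>n\<close> is quantified inside the main statement, so points are coordinate functions
  on \<open>{1..n}\<close>, taken to be extensional (\<open>PiE\<close>) so that each point has one representative.\<close>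

type_synonym point = "nat \<Rightarrow> real"

definition cube :: "nat \<Rightarrow> point set" where
  "cube n = ({1..n} \<rightarrow>\<^sub>E {0..1})"

definition cube_borel :: "nat \<Rightarrow> point measure" where
  "cube_borel n = PiM {1..n} (\<lambda>_. restrict_space borel {0..1})"

lemma space_cube_borel: "space (cube_borel n) = cube n"
  by (simp add: cube_borel_def cube_def space_PiM space_restrict_space)

datatype dtree = Label bool | Test nat real dtree dtree

primrec dt_eval :: "dtree \<Rightarrow> point \<Rightarrow> bool" where
  "dt_eval (Label b) x = b"
| "dt_eval (Test i t l r) x = (if x i < t then dt_eval l x else dt_eval r x)"

primrec dt_nodes :: "dtree \<Rightarrow> nat" where
  "dt_nodes (Label b) = 0"
| "dt_nodes (Test i t l r) = Suc (dt_nodes l + dt_nodes r)"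

primrec dt_vars :: "dtree \<Rightarrow> nat set" where
  "dt_vars (Label b) = {}"
| "dt_vars (Test i t l r) = insert i (dt_vars l \<union> dt_vars r)"

text \<open>A function on the cube is represented by any total function agreeing with it on the cube;
  values elsewhere are irrelevant here and in everything below.\<close>

definition tree_class :: "nat \<Rightarrow> nat \<Rightarrow> (point \<Rightarrow> bool) set" where
  "tree_class n k = {f. \<exists>T. dt_nodes T \<le> k \<and> dt_vars T \<subseteq> {1..n} \<and> (\<forall>x\<in>cube n. f x = dt_eval T x)}"


section \<open>Distributions and distances\<close>

text \<open>\<open>B\<close> is the domain with its standard sigma-algebra. A distribution may live on any finer
  sigma-algebra. This covers the Borel distributions, and also the finitely supported
  ones as measures on the full power set, for which every function is measurable.\<close>

definition distributions :: "'a measure \<Rightarrow> 'a measure set" where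
  "distributions B = {D. prob_space D \<and> space D = space B \<and> sets B \<subseteq> sets D}"

lemma pmf_in_distributions:
  assumes "set_pmf p \<subseteq> space B"
  shows "restrict_space (measure_pmf p) (space B) \<in> distributions B"
    and "f \<in> restrict_space (measure_pmf p) (space B) \<rightarrow>\<^sub>M count_space UNIV"
proof -
  have "emeasure (measure_pmf p) (space B) = 1"
    using assms by (subst measure_pmf.emeasure_eq_1_AE) (auto simp: AE_measure_pmf_iff)
  then have "prob_space (restrict_space (measure_pmf p) (space B))"
    by (intro prob_spaceI) (simp add: space_restrict_space emeasure_restrict_space)
  moreover have "sets (restrict_space (measure_pmf p) (space B)) = Pow (space B)"
    by (auto simp: sets_restrict_space)
  ultimately show "restrict_space (measure_pmf p) (space B) \<in> distributions B"
    using sets.space_closed[of B] by (simp add: distributions_def space_restrict_space)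
  show "f \<in> restrict_space (measure_pmf p) (space B) \<rightarrow>\<^sub>M count_space UNIV"
    by (rule measurable_restrict_space1) simp
qed

definition fun_dist :: "'a measure \<Rightarrow> ('a \<Rightarrow> bool) \<Rightarrow> ('a \<Rightarrow> bool) \<Rightarrow> real" where
  "fun_dist D f g = measure D {x \<in> space D. f x \<noteq> g x}"

definition class_dist :: "'a measure \<Rightarrow> ('a \<Rightarrow> bool) \<Rightarrow> ('a \<Rightarrow> bool) set \<Rightarrow> real" where
  "class_dist D f H = (INF h\<in>H. fun_dist D f h)"

text \<open>Testers are not required to be measurable. The probability of a possibly non-measurable event
  is its inner probability, which is the usual probability for measurable events.\<close>

definition prob_at_least :: "'a measure \<Rightarrow> ('a \<Rightarrow> bool) \<Rightarrow> real \<Rightarrow> bool" where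
  "prob_at_least M P p \<longleftrightarrow> (\<exists>E\<in>sets M. (\<forall>x\<in>E. P x) \<and> p \<le> measure M E)"

lemma prob_at_least_measurable:
  assumes "prob_space M" "{x \<in> space M. P x} \<in> sets M"
  shows "prob_at_least M P p \<longleftrightarrow> p \<le> measure M {x \<in> space M. P x}"
proof -
  interpret prob_space M by fact
  show ?thesis
  proof
    assume "prob_at_least M P p"
    then obtain E where E: "E \<in> sets M" "\<forall>x\<in>E. P x" "p \<le> measure M E"
      unfolding prob_at_least_def by blast
    have "E \<subseteq> {x \<in> space M. P x}"
      using E sets.sets_into_space by blast
    from finite_measure_mono[OF this assms(2)] show "p \<le> measure M {x \<in> space M. P x}"
      using E(3) by (rule order_trans[rotated])
  next
    assume "p \<le> measure M {x \<in> space M. P x}"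
    moreover have "\<forall>x\<in>{x \<in> space M. P x}. P x"
      by simp
    ultimately show "prob_at_least M P p"
      unfolding prob_at_least_def using assms(2) by (intro bexI[of _ "{x \<in> space M. P x}"] conjI)
  qed
qed


section \<open>Testing from labelled samples\<close>

text \<open>A randomized algorithm is a family of deterministic algorithms indexed by a seed. The seed is
  drawn from an arbitrary probability space on the reals, independently of the samples.\<close>

type_synonym 'a sample_alg = "('a \<times> bool) list \<Rightarrow> bool"

definition accepts_sample ::
    "nat \<Rightarrow> ('a \<Rightarrow> bool) \<Rightarrow> (real \<Rightarrow> 'a sample_alg) \<Rightarrow> real \<times> (nat \<Rightarrow> 'a) \<Rightarrow> bool" where
  "accepts_sample m f A = (\<lambda>(s, x). A s (map (\<lambda>i. (x i, f (x i))) [0..<m]))"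

definition sample_tester ::
    "'a measure \<Rightarrow> ('a \<Rightarrow> bool) set \<Rightarrow> real \<Rightarrow> nat \<Rightarrow> real measure \<Rightarrow> (real \<Rightarrow> 'a sample_alg) \<Rightarrow> bool" where
  "sample_tester B H \<epsilon> m R A \<longleftrightarrow> prob_space R \<and>
     (\<forall>D\<in>distributions B. \<forall>f \<in> D \<rightarrow>\<^sub>M count_space UNIV.
        (f \<in> H \<longrightarrow>
           prob_at_least (R \<Otimes>\<^sub>M PiM {..<m} (\<lambda>_. D)) (accepts_sample m f A) (2/3)) \<and>
        (class_dist D f H \<ge> \<epsilon> \<longrightarrow>
           prob_at_least (R \<Otimes>\<^sub>M PiM {..<m} (\<lambda>_. D)) (\<lambda>\<omega>. \<not> accepts_sample m f A \<omega>) (2/3)))"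

text \<open>The infimum in \<open>enat\<close> is a minimum when a tester exists, and \<open>\<infinity>\<close> otherwise.\<close>

definition m_test :: "'a measure \<Rightarrow> ('a \<Rightarrow> bool) set \<Rightarrow> real \<Rightarrow> enat" where
  "m_test B H \<epsilon> = (INF m\<in>{m. \<exists>R A. sample_tester B H \<epsilon> m R A}. enat m)"


section \<open>Testing with queries and labelled samples\<close>

text \<open>Deterministic adaptive algorithms: each step either halts with a verdict (\<open>True\<close> accepts), queries
  the function at a chosen point, or draws a fresh labelled sample.\<close>

datatype (dead 'a) query_alg =
    Verdict bool
  | Query 'a "bool \<Rightarrow> 'a query_alg"
  | Sample "'a \<times> bool \<Rightarrow> 'a query_alg"

text \<open>\<open>query_bounded X q a\<close>: every run of \<open>a\<close> on a function on \<open>X\<close> takes at most \<open>q\<close> queries and samples in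
  total, and queries only points of \<open>X\<close>.\<close>

inductive query_bounded :: "'a set \<Rightarrow> nat \<Rightarrow> 'a query_alg \<Rightarrow> bool" for X where
  "query_bounded X q (Verdict b)"
| "x \<in> X \<Longrightarrow> (\<And>b. query_bounded X q (K b)) \<Longrightarrow> query_bounded X (Suc q) (Query x K)"
| "(\<And>x b. x \<in> X \<Longrightarrow> query_bounded X q (K (x, b))) \<Longrightarrow> query_bounded X (Suc q) (Sample K)"

text \<open>\<open>run f x a i\<close> runs \<open>a\<close> with its samples read off \<open>x i\<close>, \<open>x (Suc i)\<close>, and so on. An algorithm
  bounded by \<open>q\<close> reads at most the first \<open>q\<close> entries when started at \<open>i = 0\<close>.\<close>

primrec run :: "('a \<Rightarrow> bool) \<Rightarrow> (nat \<Rightarrow> 'a) \<Rightarrow> 'a query_alg \<Rightarrow> nat \<Rightarrow> bool" where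
  "run f x (Verdict b) = (\<lambda>i. b)"
| "run f x (Query y K) = (\<lambda>i. run f x (K (f y)) i)"
| "run f x (Sample K) = (\<lambda>i. run f x (K (x i, f (x i))) (Suc i))"

definition accepts_query ::
    "('a \<Rightarrow> bool) \<Rightarrow> (real \<Rightarrow> 'a query_alg) \<Rightarrow> real \<times> (nat \<Rightarrow> 'a) \<Rightarrow> bool" where
  "accepts_query f A = (\<lambda>(s, x). run f x (A s) 0)"

definition query_tester0 ::
    "'a measure \<Rightarrow> ('a \<Rightarrow> bool) set \<Rightarrow> real \<Rightarrow> nat \<Rightarrow> real measure \<Rightarrow> (real \<Rightarrow> 'a query_alg) \<Rightarrow> bool" where
  "query_tester0 B H \<epsilon> q R A \<longleftrightarrow> prob_space R \<and> (\<forall>s\<in>space R. query_bounded (space B) q (A s)) \<and>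
     (\<forall>D\<in>distributions B. \<forall>f \<in> D \<rightarrow>\<^sub>M count_space UNIV.
        (class_dist D f H = 0 \<longrightarrow>
           prob_at_least (R \<Otimes>\<^sub>M PiM {..<q} (\<lambda>_. D)) (accepts_query f A) (2/3)) \<and>
        (class_dist D f H \<ge> \<epsilon> \<longrightarrow>
           prob_at_least (R \<Otimes>\<^sub>M PiM {..<q} (\<lambda>_. D)) (\<lambda>\<omega>. \<not> accepts_query f A \<omega>) (2/3)))"

definition q_test0 :: "'a measure \<Rightarrow> ('a \<Rightarrow> bool) set \<Rightarrow> real \<Rightarrow> enat" where
  "q_test0 B H \<epsilon> = (INF q\<in>{q. \<exists>R A. query_tester0 B H \<epsilon> q R A}. enat q)"

end

theory Submission
  imports Defs "HOL-Real_Asymp.Real_Asymp"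
begin

text \<open>Fix points on a segment of the cube, labelled alternately. Trees with \<open>k\<close> nodes fit any \<open>k + 1\<close> of
  the points exactly, but they change value at most \<open>k\<close> times along the segment and so err on a
  constant fraction of noticeably more than \<open>k\<close> points. The labelling being known, queries carry no
  information, and testing reduces to telling distributions with support at most \<open>k + 1\<close> from
  distributions on \<open>N \<ge> (1 + \<Omega>(1)) k\<close> points with all weights of order \<open>1 / N\<close>.

  The weights are drawn independently, proportionally to one of two variables with the same moments
  up to an order \<open>L\<close> proportional to \<open>log N\<close> and values in \<open>[0, O(L\<^sup>2)]\<close>. One of them vanishes with constant
  probability, the other is at least 1, and both have bounded mean. With \<open>c N / log N\<close> Poissonized samples
  the acceptance probability is, in each weight, an \<open>exp (- u)\<close> multiple of a power series whose
  contribution beyond degree \<open>L\<close> is smaller than \<open>1 / N\<close>. Exchanging the weights one at a time then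
  shows that the two priors are accepted with nearly the same probability.\<close>

section \<open>Two distributions with matching moments\<close>

text \<open>The logarithm comes from one trade-off, that of the classical lower bound for support
  size. Matching \<open>2 * m\<close> moments is paid for with values of order \<open>m^2\<close>.
  Terms of degree beyond \<open>2 * m\<close> are negligible against \<open>1 / N\<close> once the
  Poisson rate \<open>lam * u\<close> of a single point stays below a small multiple of
  \<open>m\<close>, so \<open>lam\<close> is taken of order \<open>1 / m\<close>. The mean of the
  weights is bounded, so about \<open>N / m\<close> samples are drawn, and \<open>m\<close> of order
  \<open>log N\<close> makes the error small enough for \<open>N\<close> exchanges. The obstacle is
  normalization: samples are drawn from weights divided by their random total \<open>s\<close>, and
  this denominator couples all coordinates. Weighting by the Poisson probability
  \<open>exp (- s) * s ^ M / fact M\<close> of drawing \<open>M\<close> samples, of which the first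
  \<open>q\<close> are shown to the tester, cancels \<open>s ^ q\<close> whenever \<open>M\<close>
  is at least \<open>q\<close>, and \<open>exp (- s)\<close> splits over the coordinates.\<close>

lemma sum_roots_of_unity_power:
  fixes N e :: nat
  assumes "N \<ge> 1"
  shows "(\<Sum>j<N. cis (2 * pi * real j / real N) ^ e) = (if N dvd e then of_nat N else 0)"
proof -
  define w where "w = cis (2 * pi * real e / real N)"
  have "w = exp (2 * complex_of_real pi * \<i> * complex_of_nat e / complex_of_nat N)"
    unfolding w_def cis_conv_exp by (simp add: mult_ac)
  with complex_root_unity_eq_1[OF assms, of e] have w1: "w = 1 \<longleftrightarrow> N dvd e" by simp
  have eq: "cis (2 * pi * real j / real N) ^ e = w ^ j" for j
    unfolding w_def Complex.DeMoivre by (simp add: field_simps)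
  have "w ^ N = cis (2 * pi * real e)"
    unfolding w_def Complex.DeMoivre using assms by simp
  also have "\<dots> = 1" by (metis cis_multiple_2pi Ints_of_nat)
  finally have "w ^ N = 1" .
  then show ?thesis
    using w1 by (cases "w = 1") (simp_all add: eq geometric_sum)
qed

text \<open>Summing over the \<open>N\<close>-th roots of unity keeps exactly the coefficients in
  degrees divisible by \<open>N\<close>; below degree \<open>N\<close> that is the constant
  coefficient alone.\<close>

lemma sum_poly_roots_of_unity:
  fixes p :: "complex poly"
  assumes "degree p < N" "coeff p 0 = 0"
  shows "(\<Sum>j<N. poly p (cis (2 * pi * real j / real N))) = 0"
proof -
  have "(\<Sum>j<N. poly p (cis (2 * pi * real j / real N))) =
    (\<Sum>i\<le>degree p. coeff p i * (\<Sum>j<N. cis (2 * pi * real j / real N) ^ i))"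
    unfolding poly_altdef sum_distrib_left by (rule sum.swap)
  also have "\<dots> = 0"
  proof (rule sum.neutral, intro ballI)
    fix i assume "i \<in> {..degree p}"
    with assms(1) have "i < N" by simp
    then show "coeff p i * (\<Sum>j<N. cis (2 * pi * real j / real N) ^ i) = 0"
      using assms(2) by (subst sum_roots_of_unity_power) (auto dest: dvd_imp_le)
  qed
  finally show ?thesis .
qed

lemma abs_sin_mult_le: "\<bar>sin (real n * x)\<bar> \<le> real n * \<bar>sin x\<bar>"
proof (induction n)
  case (Suc n)
  have "\<bar>sin (real (Suc n) * x)\<bar> \<le> \<bar>sin (real n * x) * cos x\<bar> + \<bar>cos (real n * x) * sin x\<bar>"
    by (simp add: distrib_right sin_add add.commute[of x])
  also have "\<dots> \<le> \<bar>sin (real n * x)\<bar> * 1 + 1 * \<bar>sin x\<bar>"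
    unfolding abs_mult by (intro add_mono mult_mono) auto
  also have "\<dots> \<le> real (Suc n) * \<bar>sin x\<bar>"
    using Suc by (simp add: algebra_simps)
  finally show ?case .
qed simp

lemma pmf_of_weights:
  fixes w :: "'a \<Rightarrow> real"
  assumes "finite A" "\<And>x. x \<in> A \<Longrightarrow> 0 \<le> w x" "sum w A = 1"
  obtains p where "set_pmf p \<subseteq> A" "\<And>x. x \<in> A \<Longrightarrow> pmf p x = w x"
proof -
  define f where "f x = (if x \<in> A then w x else 0)" for x
  have nn: "0 \<le> f x" for x using assms by (simp add: f_def)
  have "(\<integral>\<^sup>+ x. ennreal (f x) \<partial>count_space UNIV) = (\<Sum>x\<in>A. ennreal (f x))"
    using assms(1) by (intro nn_integral_count_space') (auto simp: f_def)
  also have "\<dots> = ennreal (sum f A)" using nn by simp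
  also have "sum f A = 1" using assms(3) by (simp add: f_def)
  finally have one: "(\<integral>\<^sup>+ x. ennreal (f x) \<partial>count_space UNIV) = 1" by simp
  show ?thesis
  proof (rule that[of "embed_pmf f"])
    show "set_pmf (embed_pmf f) \<subseteq> A" by (auto simp: set_embed_pmf[OF nn one] f_def)
    show "pmf (embed_pmf f) x = w x" if "x \<in> A" for x
      using that by (simp add: pmf_embed_pmf[OF nn one] f_def)
  qed
qed

text \<open>The two mixing distributions live on the even and the odd nodes \<open>n\<^sup>2 sin\<^sup>2 (\<pi> j / (2 n))\<close>,
  \<open>n = 4 m\<close>, with weights given by the squared Fejer kernel. The alternating sum against the weights
  annihilates polynomials of small degree because the kernel has degree \<open>2 (m - 1)\<close> in the cosine;
  its concentration at 0 gives the constant mass at 0 and the bounded mean.\<close>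

locale fejer_nodes =
  fixes m n :: nat
  assumes m_pos: "m \<ge> 1" and n_def: "n = 4 * m"
begin

definition z :: "nat \<Rightarrow> complex" where "z j = cis (2 * pi * real j / real (2 * n))"
text \<open>Up to the factor \<open>m\<close>, the Fejer kernel of order \<open>m\<close> at the
  angle \<open>pi * j / n\<close>. The weights below are its squares, a Jackson-type kernel: with
  first powers, the bound \<open>G_node_le\<close> would only give a mean of order \<open>m\<close>
  instead of a constant.\<close>

definition G :: "nat \<Rightarrow> real" where "G j = (cmod (\<Sum>k<m. z j ^ k))\<^sup>2"
text \<open>The extremal points \<open>cos (pi * j / n)\<close> of a Chebyshev polynomial, moved to
  \<open>[0, n^2]\<close> with 1 sent to 0. They cluster quadratically near 0, which is why the
  range needs to be only of order \<open>m^2\<close>.\<close>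

definition node :: "nat \<Rightarrow> real" where "node j = (real n)\<^sup>2 * (sin (pi * real j / real (2 * n)))\<^sup>2"

lemma n_pos: "n > 0" using m_pos n_def by simp

lemma z_nonzero: "z j \<noteq> 0" by (simp add: z_def)

text \<open>On the unit circle conjugation is inversion, so the factor \<open>z j ^ (m - 1)\<close>
  reverses the conjugated geometric sum and clears the negative powers of the kernel.\<close>

lemma G_complex: "complex_of_real (G j) * z j ^ (m - 1) = (\<Sum>k<m. z j ^ k)\<^sup>2"
proof -
  have "cnj (\<Sum>k<m. z j ^ k) * z j ^ (m - 1) = (\<Sum>k<m. cnj (z j) ^ k * z j ^ (m - 1))"
    by (simp add: sum_distrib_right)
  also have "\<dots> = (\<Sum>k<m. z j ^ (m - Suc k))"
  proof (rule sum.cong)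
    fix k assume "k \<in> {..<m}"
    then have "z j ^ (m - 1) = z j ^ k * z j ^ (m - Suc k)"
      by (simp flip: power_add)
    moreover have "cnj (z j) ^ k * z j ^ k = 1"
      by (simp add: z_def cis_cnj cis_mult flip: power_mult_distrib)
    ultimately show "cnj (z j) ^ k * z j ^ (m - 1) = z j ^ (m - Suc k)"
      by (metis mult.assoc mult.left_neutral)
  qed simp
  also have "\<dots> = (\<Sum>k<m. z j ^ k)"
    by (rule sum.nat_diff_reindex)
  finally have "cnj (\<Sum>k<m. z j ^ k) * z j ^ (m - 1) = (\<Sum>k<m. z j ^ k)" .
  then show ?thesis
    unfolding G_def complex_norm_square by (simp only: mult.assoc power2_eq_square)
qed

lemma node_complex: "complex_of_real (node j) * z j = - ((of_nat n)\<^sup>2 / 4) * (z j - 1)\<^sup>2"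
proof -
  define t where "t = pi * real j / real (2 * n)"
  have z: "z j = cis (2 * t)" by (simp add: z_def t_def)
  have c: "cis (2 * t) = (cis t)\<^sup>2" by (simp add: Complex.DeMoivre)
  have "cis (2 * t) - 1 = cis t * (cis t - cis (- t))"
    by (simp add: right_diff_distrib cis_mult)
  also have "cis t - cis (- t) = 2 * \<i> * complex_of_real (sin t)"
    by (simp add: complex_eq_iff)
  finally have "(z j - 1)\<^sup>2 = - 4 * (complex_of_real (sin t))\<^sup>2 * z j"
    unfolding z c by (simp add: power_mult_distrib)
  moreover have "complex_of_real (node j) = (of_nat n)\<^sup>2 * (complex_of_real (sin t))\<^sup>2"
    by (simp add: node_def t_def)
  ultimately show ?thesis by simp
qed

lemma z_power_n: "z j ^ n = (-1) ^ j"
proof -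
  have "z j ^ n = cis (real j * pi)"
    unfolding z_def Complex.DeMoivre using n_pos by (simp add: mult.commute)
  also have "\<dots> = cis pi ^ j" by (simp only: Complex.DeMoivre)
  finally show ?thesis by simp
qed

text \<open>The sign \<open>(-1) ^ j\<close> is \<open>z j ^ n\<close>, so this is a sum over the
  \<open>2 * n\<close>-th roots of unity. Kernel and nodes form a Laurent polynomial reaching degree
  \<open>D = 2 * (m - 1) + d\<close> on either side. As \<open>D < n\<close>, the factor
  \<open>z j ^ n\<close> moves all exponents strictly between 0 and \<open>2 * n\<close>, where the
  sums vanish.\<close>

lemma alternating_sum_eq_0:
  assumes "d \<le> 2 * m"
  shows "(\<Sum>j<2*n. (-1) ^ j * ((G j)\<^sup>2 * node j ^ d)) = 0"
proof -
  define D where "D = 2 * (m - 1) + d"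
  have D: "D < n" using assms m_pos by (simp add: D_def n_def)
  define K :: "complex poly" where "K = (\<Sum>k<m. monom 1 k)"
  define Q :: "complex poly" where "Q = smult (- ((of_nat n)\<^sup>2 / 4)) ([:-1, 1:]\<^sup>2)"
  define p where "p = monom 1 (n - D) * (K ^ 4 * Q ^ d)"
  have K: "poly K x = (\<Sum>k<m. x ^ k)" for x by (simp add: K_def poly_sum poly_monom)
  have Q: "poly Q x = - ((of_nat n)\<^sup>2 / 4) * (x - 1)\<^sup>2" for x by (simp add: Q_def)
  have dK: "degree K \<le> m - 1"
    unfolding K_def by (rule degree_sum_le) (auto intro: order_trans[OF degree_monom_le])
  have dQ: "degree Q \<le> 2"
    unfolding Q_def by (rule order_trans[OF degree_smult_le]) (simp add: degree_power_eq)
  have "degree (K ^ 4) \<le> 4 * (m - 1)" "degree (Q ^ d) \<le> d * 2"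
    using degree_power_le[of K 4] degree_power_le[of Q d] dK mult_le_mono1[OF dQ, of d]
    by linarith+
  then have "degree p \<le> (n - D) + (4 * (m - 1) + d * 2)"
    unfolding p_def
    by (intro order_trans[OF degree_mult_le] add_mono degree_monom_le)
  also have "\<dots> < 2 * n" using D by (simp add: D_def)
  finally have deg: "degree p < 2 * n" .
  have c0: "coeff p 0 = 0" using D by (simp add: p_def coeff_monom_mult)
  have "complex_of_real ((-1) ^ j * ((G j)\<^sup>2 * node j ^ d)) = poly p (z j)" for j
  proof -
    have "poly p (z j) = z j ^ (n - D) * (((complex_of_real (G j) * z j ^ (m - 1))\<^sup>2)
        * (complex_of_real (node j) * z j) ^ d)"
      unfolding p_def G_complex node_complex by (simp add: K Q poly_monom)
    also have "\<dots> = z j ^ ((n - D) + (2 * (m - 1) + d)) * complex_of_real ((G j)\<^sup>2 * node j ^ d)"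
      by (simp add: power_add power_mult power_mult_distrib mult_ac power2_eq_square)
    also have "(n - D) + (2 * (m - 1) + d) = n" using D by (simp add: D_def)
    finally show ?thesis by (simp add: z_power_n)
  qed
  then have "complex_of_real (\<Sum>j<2*n. (-1) ^ j * ((G j)\<^sup>2 * node j ^ d)) = (\<Sum>j<2*n. poly p (z j))"
    by (simp add: of_real_sum)
  also have "\<dots> = 0"
    unfolding z_def by (rule sum_poly_roots_of_unity[OF deg c0])
  finally show ?thesis by (simp only: of_real_eq_0_iff)
qed

text \<open>Orthogonality leaves the \<open>m\<close> diagonal terms of the squared modulus. The
  exponents \<open>k - l\<close> are shifted by \<open>2 * n\<close>, which does not affect the
  powers of \<open>z j\<close> and keeps the natural subtraction exact.\<close>

lemma sum_G: "(\<Sum>j<2*n. G j) = 2 * real n * real m"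
proof -
  have n1: "2 * n \<ge> 1" using n_pos by simp
  have "complex_of_real (G j) = (\<Sum>k<m. \<Sum>l<m. z j ^ (2 * n + k - l))" for j
  proof -
    have *: "cnj (z j) ^ l = z j ^ (2 * n - l)" if "l < m" for l
    proof -
      have "z j ^ (2 * n - l) * z j ^ l = z j ^ (2 * n)"
        using that by (simp add: n_def flip: power_add)
      also have "\<dots> = ((-1) ^ j)\<^sup>2" by (metis mult.commute power_mult z_power_n)
      also have "\<dots> = 1" by (simp flip: power_mult)
      finally have "z j ^ (2 * n - l) * z j ^ l = 1" .
      moreover have "cnj (z j) ^ l * z j ^ l = 1"
        by (simp add: z_def cis_cnj cis_mult flip: power_mult_distrib)
      ultimately show ?thesis using z_nonzero[of j] by (metis mult_right_cancel power_not_zero)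
    qed
    have "complex_of_real (G j) = (\<Sum>k<m. z j ^ k) * (\<Sum>l<m. cnj (z j) ^ l)"
      unfolding G_def complex_norm_square by simp
    also have "\<dots> = (\<Sum>k<m. \<Sum>l<m. z j ^ k * z j ^ (2 * n - l))"
      unfolding sum_product by (intro sum.cong refl) (simp add: *)
    also have "\<dots> = (\<Sum>k<m. \<Sum>l<m. z j ^ (2 * n + k - l))"
    proof (intro sum.cong refl)
      fix k l assume "l \<in> {..<m}"
      then have "k + (2 * n - l) = 2 * n + k - l" using n_def by simp
      then show "z j ^ k * z j ^ (2 * n - l) = z j ^ (2 * n + k - l)"
        by (simp only: power_add[symmetric])
    qed
    finally show ?thesis .
  qed
  then have "complex_of_real (\<Sum>j<2*n. G j) = (\<Sum>j<2*n. \<Sum>k<m. \<Sum>l<m. z j ^ (2 * n + k - l))"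
    by (simp add: of_real_sum)
  also have "\<dots> = (\<Sum>k<m. \<Sum>l<m. \<Sum>j<2*n. z j ^ (2 * n + k - l))"
  proof -
    have "(\<Sum>j<2*n. \<Sum>k<m. \<Sum>l<m. z j ^ (2 * n + k - l)) = (\<Sum>k<m. \<Sum>j<2*n. \<Sum>l<m. z j ^ (2 * n + k - l))"
      by (rule sum.swap)
    also have "\<dots> = (\<Sum>k<m. \<Sum>l<m. \<Sum>j<2*n. z j ^ (2 * n + k - l))"
      by (rule sum.cong[OF refl], rule sum.swap)
    finally show ?thesis .
  qed
  also have "\<dots> = (\<Sum>k<m. \<Sum>l<m. if k = l then of_nat (2 * n) else 0)"
  proof (intro sum.cong refl)
    fix k l assume "k \<in> {..<m}" "l \<in> {..<m}"
    then have kl: "k < m" "l < m" by auto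
    have "2 * n dvd 2 * n + k - l \<longleftrightarrow> k = l"
    proof
      assume "2 * n dvd 2 * n + k - l"
      then obtain c where c: "2 * n + k - l = 2 * n * c" by (auto elim: dvdE)
      have "2 * n * c < 2 * n * 2" "2 * n * 0 < 2 * n * c"
        unfolding c[symmetric] using kl n_def by simp_all
      then have "c < 2" "0 < c" unfolding nat_mult_less_cancel1 by simp_all
      then have "c = 1" by simp
      with c kl n_def show "k = l" by simp
    qed simp
    then show "(\<Sum>j<2*n. z j ^ (2 * n + k - l)) = (if k = l then of_nat (2 * n) else 0)"
      unfolding z_def by (subst sum_roots_of_unity_power[OF n1]) simp
  qed
  also have "\<dots> = complex_of_real (2 * real n * real m)" by simp
  finally show ?thesis by (simp only: of_real_eq_iff)
qed

lemma G_nonneg: "0 \<le> G j" by (simp add: G_def)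

lemma node_nonneg: "0 \<le> node j" by (simp add: node_def)

lemma G_le: "G j \<le> (real m)\<^sup>2"
proof -
  have "cmod (\<Sum>k<m. z j ^ k) \<le> (\<Sum>k<m. cmod (z j ^ k))" by (rule norm_sum)
  also have "\<dots> = real m" by (simp add: z_def norm_power)
  finally show ?thesis unfolding G_def by (simp add: power_mono)
qed

lemma G_0: "G 0 = (real m)\<^sup>2" by (simp add: G_def z_def)

lemma node_0: "node 0 = 0" by (simp add: node_def)

lemma node_le: "node j \<le> (real n)\<^sup>2"
  unfolding node_def by (rule mult_left_le) (auto simp: power_le_one abs_square_le_1)

text \<open>For odd \<open>j\<close> the angle \<open>n * t\<close> is an odd multiple of
  \<open>pi / 2\<close>, where the sine has absolute value 1; passing from \<open>t\<close> to
  \<open>n * t\<close> enlarges it at most \<open>n\<close> times.\<close>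

lemma node_odd_ge_1:
  assumes "odd j"
  shows "1 \<le> node j"
proof -
  define t where "t = pi * real j / real (2 * n)"
  have "real n * t = real j * (pi / 2)" using n_pos by (simp add: t_def)
  moreover obtain i where "j = Suc (2 * i)" using assms by (auto elim: oddE)
  ultimately have "sin (real n * t) = cos (real i * pi)"
    by (simp add: algebra_simps sin_add cos_add)
  then have "\<bar>sin (real n * t)\<bar> = 1" by (simp add: cos_npi power_abs)
  with abs_sin_mult_le[of n t] have "1 \<le> real n * \<bar>sin t\<bar>" by simp
  then have "1 \<le> (real n * \<bar>sin t\<bar>)\<^sup>2" by (metis one_le_power)
  then show ?thesis unfolding node_def t_def[symmetric] by (simp add: power_mult_distrib)
qed

text \<open>The geometric sum times \<open>z j - 1\<close> is \<open>z j ^ m - 1\<close>, of modulus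
  at most 2, and \<open>node j\<close> is \<open>n^2 / 4\<close> times the squared modulus of
  \<open>z j - 1\<close>. Thus the decay of the kernel offsets the growth of the nodes.\<close>

lemma G_node_le: "G j * node j \<le> (real n)\<^sup>2"
proof -
  have "(\<Sum>k<m. z j ^ k) * (z j - 1) = z j ^ m - 1"
    by (simp add: power_diff_1_eq mult.commute)
  then have "cmod (\<Sum>k<m. z j ^ k) * cmod (z j - 1) = cmod (z j ^ m - 1)"
    by (metis norm_mult)
  also have "\<dots> \<le> 2"
    by (rule order_trans[OF norm_triangle_ineq4]) (simp add: z_def norm_power)
  finally have "(cmod (\<Sum>k<m. z j ^ k) * cmod (z j - 1))\<^sup>2 \<le> 2\<^sup>2" by (intro power_mono) auto
  then have 1: "G j * (cmod (z j - 1))\<^sup>2 \<le> 4" by (simp add: G_def power_mult_distrib)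
  have "node j = cmod (complex_of_real (node j) * z j)"
    using node_nonneg[of j] by (simp add: norm_mult z_def)
  also have "\<dots> = ((real n)\<^sup>2 / 4) * (cmod (z j - 1))\<^sup>2"
    unfolding node_complex by (simp add: norm_mult norm_power norm_divide)
  finally have "G j * node j = ((real n)\<^sup>2 / 4) * (G j * (cmod (z j - 1))\<^sup>2)" by simp
  also have "\<dots> \<le> ((real n)\<^sup>2 / 4) * 4" using 1 by (intro mult_left_mono) auto
  finally show ?thesis by simp
qed

end

theorem matched_moments_pair:
  fixes m :: nat
  assumes "m \<ge> 1"
  obtains p p' :: "real pmf" where
    "finite (set_pmf p)" "finite (set_pmf p')"
    "set_pmf p \<subseteq> {0..16 * (real m)\<^sup>2}" "set_pmf p' \<subseteq> {1..16 * (real m)\<^sup>2}"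
    "pmf p 0 \<ge> 1/4"
    "\<And>d. d \<le> 2 * m \<Longrightarrow> measure_pmf.expectation p (\<lambda>x. x ^ d) = measure_pmf.expectation p' (\<lambda>x. x ^ d)"
    "measure_pmf.expectation p (\<lambda>x. x) \<le> 128"
proof -
  interpret fejer_nodes m "4 * m" using assms by unfold_locales auto
  define n where "n = 4 * m"
  define E where "E = {j. j < 2 * n \<and> even j}"
  define O' where "O' = {j. j < 2 * n \<and> odd j}"
  have fin: "finite E" "finite O'" by (auto simp: E_def O'_def)
  have split: "(\<Sum>j<2*n. h j) = sum h E + sum h O'" for h :: "nat \<Rightarrow> real"
  proof -
    have "{..<2*n} = E \<union> O'" "E \<inter> O' = {}" by (auto simp: E_def O'_def)
    then show ?thesis using fin by (simp add: sum.union_disjoint)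
  qed
  have bal: "(\<Sum>j\<in>E. (G j)\<^sup>2 * node j ^ d) = (\<Sum>j\<in>O'. (G j)\<^sup>2 * node j ^ d)" if "d \<le> 2 * m" for d
  proof -
    have "(\<Sum>j\<in>E. (-1) ^ j * ((G j)\<^sup>2 * node j ^ d)) = (\<Sum>j\<in>E. (G j)\<^sup>2 * node j ^ d)"
      "(\<Sum>j\<in>O'. (-1) ^ j * ((G j)\<^sup>2 * node j ^ d)) = - (\<Sum>j\<in>O'. (G j)\<^sup>2 * node j ^ d)"
      unfolding sum_negf[symmetric] by (intro sum.cong; simp add: E_def O'_def)+
    with alternating_sum_eq_0[OF that] show ?thesis by (simp add: split flip: n_def)
  qed
  define W where "W = (\<Sum>j\<in>E. (G j)\<^sup>2)"
  have W': "W = (\<Sum>j\<in>O'. (G j)\<^sup>2)" using bal[of 0] by (simp add: W_def)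
  have sG: "(\<Sum>j<2*n. G j) = 2 * real n * real m" using sum_G by (simp add: n_def)
  \<comment> \<open>\<open>W\<close> lies between \<open>m^4\<close> and \<open>4 * m^4\<close>. The
    lower bound is the term \<open>j = 0\<close> and will bound the mean; the upper bound, from
    \<open>sum_G\<close>, will bound the mass at 0 from below.\<close>
  have "0 \<in> E" using assms by (simp add: E_def n_def)
  then have Wge: "(real m)^4 \<le> W"
    using member_le_sum[of 0 E "\<lambda>j. (G j)\<^sup>2"] fin by (simp add: W_def G_0)
  have "2 * W = (\<Sum>j<2*n. (G j)\<^sup>2)" using W' by (simp add: split W_def)
  also have "\<dots> \<le> (\<Sum>j<2*n. (real m)\<^sup>2 * G j)"
    unfolding power2_eq_square[of "G _"] by (intro sum_mono mult_right_mono G_le G_nonneg)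
  also have "\<dots> = (real m)\<^sup>2 * (2 * real n * real m)" unfolding sum_distrib_left[symmetric] sG ..
  finally have Wle: "W \<le> 4 * (real m)^4" by (simp add: n_def power2_eq_square power4_eq_xxxx)
  have m4: "(real m)^4 > 0" using assms by simp
  then have Wpos: "W > 0" using Wge by linarith
  obtain p0 where p0: "set_pmf p0 \<subseteq> E" "\<And>j. j \<in> E \<Longrightarrow> pmf p0 j = (G j)\<^sup>2 / W"
    using pmf_of_weights[of E "\<lambda>j. (G j)\<^sup>2 / W"] fin Wpos
    by (auto simp: W_def simp flip: sum_divide_distrib)
  obtain p1 where p1: "set_pmf p1 \<subseteq> O'" "\<And>j. j \<in> O' \<Longrightarrow> pmf p1 j = (G j)\<^sup>2 / W"
    using pmf_of_weights[of O' "\<lambda>j. (G j)\<^sup>2 / W"] fin Wpos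
    by (auto simp: W' simp flip: sum_divide_distrib)
  have e0: "measure_pmf.expectation (map_pmf node p0) f = (\<Sum>j\<in>E. (G j)\<^sup>2 * f (node j)) / W" for f :: "real \<Rightarrow> real"
    using fin p0 unfolding integral_map_pmf
    by (subst integral_measure_pmf[of E]) (auto simp: sum_divide_distrib intro!: sum.cong)
  have e1: "measure_pmf.expectation (map_pmf node p1) f = (\<Sum>j\<in>O'. (G j)\<^sup>2 * f (node j)) / W" for f :: "real \<Rightarrow> real"
    using fin p1 unfolding integral_map_pmf
    by (subst integral_measure_pmf[of O']) (auto simp: sum_divide_distrib intro!: sum.cong)
  show ?thesis
  proof (rule that)
    show "finite (set_pmf (map_pmf node p0))" "finite (set_pmf (map_pmf node p1))"
      using p0 p1 fin by (auto intro: finite_subset)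
    show "set_pmf (map_pmf node p0) \<subseteq> {0..16 * (real m)\<^sup>2}"
      using node_le node_nonneg by (auto simp: power_mult_distrib)
    show "set_pmf (map_pmf node p1) \<subseteq> {1..16 * (real m)\<^sup>2}"
    proof
      fix x assume "x \<in> set_pmf (map_pmf node p1)"
      then obtain j where "j \<in> O'" "x = node j" using p1 by auto
      then show "x \<in> {1..16 * (real m)\<^sup>2}"
        using node_le[of j] node_odd_ge_1[of j] by (simp add: power_mult_distrib O'_def)
    qed
    have "1/4 \<le> (real m)^4 / W" using Wle Wpos by (simp add: field_simps)
    also have "\<dots> = pmf p0 0" using p0 \<open>0 \<in> E\<close> by (simp add: G_0)
    also have "\<dots> = measure p0 {0}" by (simp add: pmf.rep_eq)
    also have "\<dots> \<le> measure p0 (node -` {0})"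
      by (intro measure_pmf.finite_measure_mono) (auto simp: node_0)
    also have "\<dots> = pmf (map_pmf node p0) 0" by (simp add: pmf_map)
    finally show "pmf (map_pmf node p0) 0 \<ge> 1/4" .
    show "measure_pmf.expectation (map_pmf node p0) (\<lambda>x. x ^ d) =
        measure_pmf.expectation (map_pmf node p1) (\<lambda>x. x ^ d)" if "d \<le> 2 * m" for d
      unfolding e0 e1 using bal[OF that] by simp
    \<comment> \<open>One factor \<open>G j\<close> absorbs the node, the other is summed exactly:
      \<open>n^2 * (2 * n * m)\<close> is \<open>128 * m^4\<close> for
      \<open>n = 4 * m\<close>.\<close>
    have "(\<Sum>j\<in>E. (G j)\<^sup>2 * node j) \<le> (\<Sum>j<2*n. (G j)\<^sup>2 * node j)"
      using fin by (intro sum_mono2) (auto simp: E_def node_nonneg)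
    also have "\<dots> \<le> (\<Sum>j<2*n. G j * (real n)\<^sup>2)"
    proof (rule sum_mono)
      fix j
      show "(G j)\<^sup>2 * node j \<le> G j * (real n)\<^sup>2"
        using mult_left_mono[OF G_node_le[of j] G_nonneg[of j]] by (simp add: power2_eq_square mult.assoc n_def)
    qed
    also have "\<dots> = 128 * (real m)^4"
      unfolding sum_distrib_right[symmetric] sG by (simp add: n_def power2_eq_square power4_eq_xxxx)
    also have "\<dots> \<le> 128 * W" using Wge by simp
    finally show "measure_pmf.expectation (map_pmf node p0) (\<lambda>x. x) \<le> 128"
      unfolding e0 using Wpos by (simp add: field_simps)
  qed
qed

section \<open>Products of distributions with matching moments\<close>

lemma expectation_pair_pmf_finite:
  fixes \<Phi> :: "'a \<Rightarrow> 'b \<Rightarrow> real"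
  assumes "finite (set_pmf p)" "finite (set_pmf q)"
  shows "measure_pmf.expectation (pair_pmf p q) (\<lambda>(a, b). \<Phi> a b) =
    measure_pmf.expectation q (\<lambda>b. measure_pmf.expectation p (\<lambda>a. \<Phi> a b))"
proof -
  have "measure_pmf.expectation (pair_pmf p q) (\<lambda>(a, b). \<Phi> a b) =
      (\<Sum>x\<in>set_pmf p \<times> set_pmf q. pmf (pair_pmf p q) x *\<^sub>R (case x of (a, b) \<Rightarrow> \<Phi> a b))"
    using assms by (intro integral_measure_pmf) auto
  also have "\<dots> = (\<Sum>(a, b)\<in>set_pmf p \<times> set_pmf q. pmf p a * pmf q b * \<Phi> a b)"
    by (intro sum.cong) (auto simp: pmf_pair)
  also have "\<dots> = (\<Sum>b\<in>set_pmf q. \<Sum>a\<in>set_pmf p. pmf p a * pmf q b * \<Phi> a b)"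
    by (subst sum.cartesian_product[symmetric]) (rule sum.swap)
  also have "\<dots> = (\<Sum>b\<in>set_pmf q. pmf q b *\<^sub>R (\<Sum>a\<in>set_pmf p. pmf p a *\<^sub>R \<Phi> a b))"
    by (simp add: sum_distrib_left mult_ac)
  also have "\<dots> = measure_pmf.expectation q (\<lambda>b. measure_pmf.expectation p (\<lambda>a. \<Phi> a b))"
    using assms by (subst (1 2) integral_measure_pmf) auto
  finally show ?thesis .
qed

lemma finite_set_Pi_pmf:
  assumes "finite A" "\<And>x. x \<in> A \<Longrightarrow> finite (set_pmf (p x))"
  shows "finite (set_pmf (Pi_pmf A d p))"
proof (rule finite_subset[OF set_Pi_pmf_subset'[OF assms(1)]])
  show "finite (PiE_dflt A d (set_pmf \<circ> p))"
    using assms by (intro finite_PiE_dflt) auto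
qed

lemma expectation_Pi_pmf_insert:
  fixes \<Phi> :: "('a \<Rightarrow> 'b) \<Rightarrow> real"
  assumes "finite A" "x \<notin> A" "\<And>i. i \<in> insert x A \<Longrightarrow> finite (set_pmf (p i))"
  shows "measure_pmf.expectation (Pi_pmf (insert x A) d p) \<Phi> =
    measure_pmf.expectation (Pi_pmf A d p) (\<lambda>f. measure_pmf.expectation (p x) (\<lambda>u. \<Phi> (f(x := u))))"
proof -
  have "measure_pmf.expectation (Pi_pmf (insert x A) d p) \<Phi> =
      measure_pmf.expectation (pair_pmf (p x) (Pi_pmf A d p)) (\<lambda>(u, f). \<Phi> (f(x := u)))"
    using assms by (simp add: Pi_pmf_insert integral_map_pmf case_prod_unfold)
  also have "\<dots> = measure_pmf.expectation (Pi_pmf A d p) (\<lambda>f. measure_pmf.expectation (p x) (\<lambda>u. \<Phi> (f(x := u))))"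
    using assms by (intro expectation_pair_pmf_finite finite_set_Pi_pmf) auto
  finally show ?thesis .
qed

lemma abs_expectation_le:
  fixes f :: "'a \<Rightarrow> real"
  assumes "finite (set_pmf p)" "\<And>x. x \<in> set_pmf p \<Longrightarrow> \<bar>f x\<bar> \<le> b"
  shows "\<bar>measure_pmf.expectation p f\<bar> \<le> b"
proof -
  have "\<bar>measure_pmf.expectation p f\<bar> \<le> measure_pmf.expectation p (\<lambda>x. \<bar>f x\<bar>)"
    by (rule integral_abs_bound)
  also have "\<dots> \<le> b"
    using assms by (intro measure_pmf.integral_le_const integrable_measure_pmf_finite) (auto simp: AE_measure_pmf_iff)
  finally show ?thesis .
qed

text \<open>Hybrid argument: \<open>H T\<close> draws the coordinates in \<open>T\<close> from
  \<open>p'\<close> and the others from \<open>p\<close>. Enlarging \<open>T\<close> by one index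
  changes a single marginal, so conditioning on the remaining coordinates leaves a difference
  controlled by \<open>swap\<close>, and each index costs one \<open>\<delta>\<close>.\<close>

lemma Lindeberg_swap:
  fixes p p' :: "'b pmf" and \<Phi> :: "('a \<Rightarrow> 'b) \<Rightarrow> real"
  assumes fin: "finite A" "finite (set_pmf p)" "finite (set_pmf p')"
    and swap: "\<And>t y. \<lbrakk>t \<in> A; \<And>i. i \<in> A - {t} \<Longrightarrow> y i \<in> set_pmf p \<union> set_pmf p'\<rbrakk> \<Longrightarrow>
      \<bar>measure_pmf.expectation p (\<lambda>u. \<Phi> (y(t := u))) - measure_pmf.expectation p' (\<lambda>u. \<Phi> (y(t := u)))\<bar> \<le> \<delta>"
  shows "\<bar>measure_pmf.expectation (Pi_pmf A d (\<lambda>_. p)) \<Phi> - measure_pmf.expectation (Pi_pmf A d (\<lambda>_. p')) \<Phi>\<bar>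
    \<le> real (card A) * \<delta>"
proof -
  define H where "H T = measure_pmf.expectation (Pi_pmf A d (\<lambda>i. if i \<in> T then p' else p)) \<Phi>" for T
  have step: "\<bar>H T - H (insert t T)\<bar> \<le> \<delta>" if t: "t \<in> A" "t \<notin> T" for T t
  proof -
    have A: "A = insert t (A - {t})" using t by auto
    define \<mu> where "\<mu> = Pi_pmf (A - {t}) d (\<lambda>i. if i \<in> T then p' else p)"
    have \<mu>': "\<mu> = Pi_pmf (A - {t}) d (\<lambda>i. if i \<in> insert t T then p' else p)"
      unfolding \<mu>_def by (intro Pi_pmf_cong) auto
    have fin\<mu>: "finite (set_pmf \<mu>)"
      unfolding \<mu>_def using fin by (intro finite_set_Pi_pmf) auto
    have "H T = measure_pmf.expectation \<mu> (\<lambda>y. measure_pmf.expectation p (\<lambda>u. \<Phi> (y(t := u))))"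
      unfolding H_def \<mu>_def using fin t by (subst A, subst expectation_Pi_pmf_insert) auto
    moreover have "H (insert t T) = measure_pmf.expectation \<mu> (\<lambda>y. measure_pmf.expectation p' (\<lambda>u. \<Phi> (y(t := u))))"
      unfolding H_def \<mu>' using fin t by (subst A, subst expectation_Pi_pmf_insert) auto
    ultimately have "H T - H (insert t T) = measure_pmf.expectation \<mu> (\<lambda>y.
        measure_pmf.expectation p (\<lambda>u. \<Phi> (y(t := u))) - measure_pmf.expectation p' (\<lambda>u. \<Phi> (y(t := u))))"
      using fin\<mu> by (simp add: Bochner_Integration.integral_diff integrable_measure_pmf_finite)
    also have "\<bar>\<dots>\<bar> \<le> \<delta>"
    proof (rule abs_expectation_le[OF fin\<mu>])
      fix y assume "y \<in> set_pmf \<mu>"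
      then have "y i \<in> set_pmf p \<union> set_pmf p'" if "i \<in> A - {t}" for i
        using set_Pi_pmf_subset'[of "A - {t}" d "\<lambda>i. if i \<in> T then p' else p"] that fin
        unfolding \<mu>_def by (force simp: PiE_dflt_def split: if_splits)
      with t show "\<bar>measure_pmf.expectation p (\<lambda>u. \<Phi> (y(t := u))) -
          measure_pmf.expectation p' (\<lambda>u. \<Phi> (y(t := u)))\<bar> \<le> \<delta>"
        by (intro swap)
    qed
    finally show ?thesis .
  qed
  have "\<bar>H {} - H T\<bar> \<le> real (card T) * \<delta>" if "T \<subseteq> A" for T
    using finite_subset[OF that fin(1)] that
  proof (induction T rule: finite_induct)
    case (insert t T)
    then have "\<bar>H {} - H T\<bar> \<le> real (card T) * \<delta>" "\<bar>H T - H (insert t T)\<bar> \<le> \<delta>"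
      using step[of t T] by auto
    then show ?case using insert.hyps by (simp add: algebra_simps)
  qed simp
  from this[of A] have "\<bar>H {} - H A\<bar> \<le> real (card A) * \<delta>" by simp
  moreover have "H A = measure_pmf.expectation (Pi_pmf A d (\<lambda>_. p')) \<Phi>"
    unfolding H_def using fin by (intro arg_cong[of _ _ "\<lambda>\<mu>. measure_pmf.expectation \<mu> \<Phi>"] Pi_pmf_cong) auto
  ultimately show ?thesis by (simp add: H_def)
qed

lemma expectation_sum_squared:
  fixes h :: "'b \<Rightarrow> real"
  assumes "finite A" "finite (set_pmf p)" and mean: "measure_pmf.expectation p h = 0"
  shows "measure_pmf.expectation (Pi_pmf A d (\<lambda>_. p)) (\<lambda>f. (\<Sum>i\<in>A. h (f i))\<^sup>2) =
    real (card A) * measure_pmf.expectation p (\<lambda>u. (h u)\<^sup>2)"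
  using assms(1)
proof (induction A rule: finite_induct)
  case (insert x A)
  have int: "integrable (measure_pmf p) g" for g :: "'b \<Rightarrow> real"
    using assms by (intro integrable_measure_pmf_finite)
  have int': "integrable (measure_pmf (Pi_pmf A d (\<lambda>_. p))) g" for g :: "('a \<Rightarrow> 'b) \<Rightarrow> real"
    using assms insert.hyps by (intro integrable_measure_pmf_finite finite_set_Pi_pmf)
  have "(\<Sum>i\<in>insert x A. h ((f(x := u)) i)) = h u + (\<Sum>i\<in>A. h (f i))" for f u
    using insert.hyps by (simp add: sum.insert) (intro sum.cong; auto)
  then have "measure_pmf.expectation p (\<lambda>u. (\<Sum>i\<in>insert x A. h ((f(x := u)) i))\<^sup>2) =
      measure_pmf.expectation p (\<lambda>u. (h u)\<^sup>2) + (\<Sum>i\<in>A. h (f i))\<^sup>2" for f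
    by (simp add: power2_sum int mean)
  then show ?case
    using insert assms(2) by (simp add: expectation_Pi_pmf_insert int' algebra_simps)
qed simp

lemma Chebyshev_Pi_pmf:
  fixes h :: "'b \<Rightarrow> real"
  assumes "finite A" "finite (set_pmf p)" "measure_pmf.expectation p h = 0" "a > 0"
  shows "measure (Pi_pmf A d (\<lambda>_. p)) {f. \<bar>\<Sum>i\<in>A. h (f i)\<bar> \<ge> a} \<le>
    real (card A) * measure_pmf.expectation p (\<lambda>u. (h u)\<^sup>2) / a\<^sup>2"
proof -
  have int: "integrable (measure_pmf (Pi_pmf A d (\<lambda>_. p))) g" for g :: "('a \<Rightarrow> 'b) \<Rightarrow> real"
    using assms by (intro integrable_measure_pmf_finite finite_set_Pi_pmf)
  have "a\<^sup>2 * measure (Pi_pmf A d (\<lambda>_. p)) {f. \<bar>\<Sum>i\<in>A. h (f i)\<bar> \<ge> a} =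
      measure_pmf.expectation (Pi_pmf A d (\<lambda>_. p)) (\<lambda>f. a\<^sup>2 * indicator {f. \<bar>\<Sum>i\<in>A. h (f i)\<bar> \<ge> a} f)"
    by simp
  also have "\<dots> \<le> measure_pmf.expectation (Pi_pmf A d (\<lambda>_. p)) (\<lambda>f. (\<Sum>i\<in>A. h (f i))\<^sup>2)"
  proof (rule integral_mono[OF int int])
    fix f
    have "a\<^sup>2 \<le> (\<Sum>i\<in>A. h (f i))\<^sup>2" if "a \<le> \<bar>\<Sum>i\<in>A. h (f i)\<bar>"
      using power_mono[OF that, of 2] assms(4) by simp
    then show "a\<^sup>2 * indicator {f. \<bar>\<Sum>i\<in>A. h (f i)\<bar> \<ge> a} f \<le> (\<Sum>i\<in>A. h (f i))\<^sup>2"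
      by (simp add: indicator_def)
  qed
  finally show ?thesis
    using assms by (simp add: expectation_sum_squared field_simps)
qed

section \<open>Taylor truncation of a polynomial times exp (- u)\<close>

lemma exp_tail_le:
  fixes z :: real
  assumes "z \<ge> 0"
  shows "summable (\<lambda>s. z ^ (s + n) / fact (s + n))"
    and "(\<Sum>s. z ^ (s + n) / fact (s + n)) \<le> z ^ n / fact n * exp z"
proof -
  have sm: "(\<lambda>s. z ^ n / fact n * (z ^ s / fact s)) sums (z ^ n / fact n * exp z)"
    using exp_converges[of z] by (intro sums_mult) (simp add: field_simps)
  have le: "z ^ (s + n) / fact (s + n) \<le> z ^ n / fact n * (z ^ s / fact s)" for s
  proof -
    have "fact s * fact n \<le> (fact (s + n) :: real)"
      using dvd_imp_le[OF fact_fact_dvd_fact[of s n]] by (metis fact_gt_zero of_nat_fact of_nat_le_iff of_nat_mult)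
    then have "z ^ (s + n) / fact (s + n) \<le> z ^ (s + n) / (fact s * fact n)"
      using assms by (intro divide_left_mono) auto
    then show ?thesis by (simp add: power_add field_simps)
  qed
  show 1: "summable (\<lambda>s. z ^ (s + n) / fact (s + n))"
    by (rule summable_comparison_test'[OF sums_summable[OF sm], of 0]) (use le assms in auto)
  show "(\<Sum>s. z ^ (s + n) / fact (s + n)) \<le> z ^ n / fact n * exp z"
    using suminf_le[OF le 1 sums_summable[OF sm]] sums_unique[OF sm] by simp
qed

lemma sum_inverse_facts: "(\<Sum>i\<le>s. 1 / (fact i * fact (s - i))) = (2 ^ s / fact s :: real)"
proof -
  have "(2::real) ^ s = (\<Sum>i\<le>s. real (s choose i))"
    by (simp add: choose_row_sum flip: of_nat_sum)
  also have "\<dots> = (\<Sum>i\<le>s. fact s * (1 / (fact i * fact (s - i))))"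
    by (intro sum.cong refl) (simp add: binomial_fact)
  also have "\<dots> = fact s * (\<Sum>i\<le>s. 1 / (fact i * fact (s - i)))"
    by (simp only: sum_distrib_left)
  finally show ?thesis by (simp add: nonzero_eq_divide_eq mult.commute)
qed

text \<open>In the Cauchy product with the series of \<open>exp (- u)\<close>, the coefficient of
  \<open>u ^ s\<close> is at most the sum of \<open>1 / (fact i * fact (s - i))\<close>, that is
  \<open>2 ^ s / fact s\<close>. So the remainder is dominated by the exponential tail at
  \<open>2 * u\<close>, uniformly in the degree of \<open>Q\<close>.\<close>

lemma poly_times_exp_approx:
  fixes Q :: "real poly"
  assumes "\<And>c. \<bar>coeff Q c\<bar> \<le> 1 / fact c"
  obtains a where "\<And>u. u \<ge> 0 \<Longrightarrow>
    \<bar>exp (- u) * poly Q u - (\<Sum>s<n. a s * u ^ s)\<bar> \<le> (2 * u) ^ n / fact n * exp (2 * u)"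
proof -
  define a where "a s = (\<Sum>i\<le>s. coeff Q i * ((-1) ^ (s - i) / fact (s - i)))" for s
  have a_le: "\<bar>a s\<bar> \<le> 2 ^ s / fact s" for s
  proof -
    have "\<bar>a s\<bar> \<le> (\<Sum>i\<le>s. \<bar>coeff Q i * ((-1) ^ (s - i) / fact (s - i))\<bar>)"
      unfolding a_def by (rule sum_abs)
    also have "\<dots> \<le> (\<Sum>i\<le>s. 1 / (fact i * fact (s - i)))"
    proof (rule sum_mono)
      fix i
      show "\<bar>coeff Q i * ((-1) ^ (s - i) / fact (s - i))\<bar> \<le> 1 / (fact i * fact (s - i))"
        using mult_right_mono[OF assms[of i], of "1 / fact (s - i)"]
        by (simp add: abs_mult power_abs)
    qed
    finally show ?thesis by (simp add: sum_inverse_facts)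
  qed
  show ?thesis
  proof (rule that[of a])
    fix u :: real assume u: "u \<ge> 0"
    have Q: "(\<lambda>i. coeff Q i * u ^ i) sums poly Q u"
      unfolding poly_altdef by (rule sums_finite) (auto simp: coeff_eq_0)
    have sQ: "summable (\<lambda>i. norm (coeff Q i * u ^ i))"
      by (rule summable_finite[of "{..degree Q}"]) (auto simp: coeff_eq_0)
    have E: "(\<lambda>i. (- u) ^ i / fact i) sums exp (- u)"
      using exp_converges[of "- u"] by (simp add: field_simps)
    have sE: "summable (\<lambda>i. norm ((- u) ^ i / fact i))"
      using summable_norm_exp[of "- u"] by (simp add: field_simps)
    have coef: "(\<Sum>i\<le>s. coeff Q i * u ^ i * ((- u) ^ (s - i) / fact (s - i))) = a s * u ^ s" for s
      unfolding a_def sum_distrib_right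
    proof (rule sum.cong[OF refl])
      fix i assume "i \<in> {..s}"
      then have "u ^ s = u ^ i * u ^ (s - i)" by (simp flip: power_add)
      then show "coeff Q i * u ^ i * ((- u) ^ (s - i) / fact (s - i)) =
          coeff Q i * ((- 1) ^ (s - i) / fact (s - i)) * u ^ s"
        by (simp add: power_minus[of u])
    qed
    have S: "(\<lambda>s. a s * u ^ s) sums (poly Q u * exp (- u))"
      using Cauchy_product_sums[OF sQ sE]
      unfolding coef sums_unique[OF Q, symmetric] sums_unique[OF E, symmetric] .
    have le: "\<bar>a (s + n) * u ^ (s + n)\<bar> \<le> (2 * u) ^ (s + n) / fact (s + n)" for s
      using mult_right_mono[OF a_le[of "s + n"], of "u ^ (s + n)"] u
      by (simp add: abs_mult power_mult_distrib)
    note tail = exp_tail_le[of "2 * u" n]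
    have sabs: "summable (\<lambda>s. \<bar>a (s + n) * u ^ (s + n)\<bar>)"
      by (rule summable_comparison_test'[of "\<lambda>s. (2 * u) ^ (s + n) / fact (s + n)" 0])
        (use tail u le in auto)
    have "exp (- u) * poly Q u - (\<Sum>s<n. a s * u ^ s) = (\<Sum>s. a (s + n) * u ^ (s + n))"
      using suminf_split_initial_segment[OF sums_summable[OF S], of n] sums_unique[OF S]
      by (simp add: mult.commute)
    also have "\<bar>\<dots>\<bar> \<le> (\<Sum>s. \<bar>a (s + n) * u ^ (s + n)\<bar>)"
      by (rule summable_rabs[OF sabs])
    also have "\<dots> \<le> (\<Sum>s. (2 * u) ^ (s + n) / fact (s + n))"
      using tail u by (intro suminf_le le sabs) auto
    also have "\<dots> \<le> (2 * u) ^ n / fact n * exp (2 * u)"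
      using tail u by simp
    finally show "\<bar>exp (- u) * poly Q u - (\<Sum>s<n. a s * u ^ s)\<bar> \<le> (2 * u) ^ n / fact n * exp (2 * u)" .
  qed
qed

text \<open>The truncation below degree \<open>n\<close> has equal means under \<open>p\<close> and
  \<open>p'\<close>; what differs are two remainders, each bounded by its estimate at the right end
  \<open>Y\<close>.\<close>

lemma moment_matching_poly_times_exp:
  fixes p p' :: "real pmf" and Q :: "real poly"
  assumes fin: "finite (set_pmf p)" "finite (set_pmf p')"
    and supp: "set_pmf p \<subseteq> {0..Y}" "set_pmf p' \<subseteq> {0..Y}"
    and moments: "\<And>d. d < n \<Longrightarrow> measure_pmf.expectation p (\<lambda>x. x ^ d) = measure_pmf.expectation p' (\<lambda>x. x ^ d)"
    and Q: "\<And>c. \<bar>coeff Q c\<bar> \<le> 1 / fact c"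
  shows "\<bar>measure_pmf.expectation p (\<lambda>u. exp (- u) * poly Q u) -
      measure_pmf.expectation p' (\<lambda>u. exp (- u) * poly Q u)\<bar> \<le> 2 * ((2 * Y) ^ n / fact n * exp (2 * Y))"
proof -
  obtain a where a: "\<And>u. u \<ge> 0 \<Longrightarrow>
      \<bar>exp (- u) * poly Q u - (\<Sum>s<n. a s * u ^ s)\<bar> \<le> (2 * u) ^ n / fact n * exp (2 * u)"
    using poly_times_exp_approx[OF Q] by blast
  define R where "R u = exp (- u) * poly Q u - (\<Sum>s<n. a s * u ^ s)" for u
  have R: "\<bar>R u\<bar> \<le> (2 * Y) ^ n / fact n * exp (2 * Y)" if "u \<in> {0..Y}" for u
  proof -
    have "(2 * u) ^ n / fact n * exp (2 * u) \<le> (2 * Y) ^ n / fact n * exp (2 * Y)"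
      using that by (intro mult_mono divide_right_mono power_mono) auto
    with a[of u] that show ?thesis by (simp add: R_def)
  qed
  have E: "measure_pmf.expectation r (\<lambda>u. exp (- u) * poly Q u) =
      (\<Sum>s<n. a s * measure_pmf.expectation r (\<lambda>x. x ^ s)) + measure_pmf.expectation r R"
    if "finite (set_pmf r)" for r
  proof -
    have int: "integrable (measure_pmf r) g" for g :: "real \<Rightarrow> real"
      using that by (intro integrable_measure_pmf_finite)
    have "measure_pmf.expectation r (\<lambda>u. exp (- u) * poly Q u) =
        measure_pmf.expectation r (\<lambda>u. (\<Sum>s<n. a s * u ^ s) + R u)"
      by (simp add: R_def)
    then show ?thesis
      by (simp add: Bochner_Integration.integral_add int Bochner_Integration.integral_sum)
  qed
  have "(\<Sum>s<n. a s * measure_pmf.expectation p (\<lambda>x. x ^ s)) = (\<Sum>s<n. a s * measure_pmf.expectation p' (\<lambda>x. x ^ s))"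
    using moments by (intro sum.cong) auto
  moreover have "\<bar>measure_pmf.expectation p R\<bar> \<le> (2 * Y) ^ n / fact n * exp (2 * Y)"
      "\<bar>measure_pmf.expectation p' R\<bar> \<le> (2 * Y) ^ n / fact n * exp (2 * Y)"
    using supp R fin by (auto intro!: abs_expectation_le)
  ultimately show ?thesis unfolding E[OF fin(1)] E[OF fin(2)] by linarith
qed

section \<open>Poissonized sampling\<close>

lemma sum_le_exp:
  fixes s :: real
  assumes "0 \<le> s" "finite A"
  shows "(\<Sum>j\<in>A. s ^ j / fact j) \<le> exp s"
proof -
  have "(\<lambda>j. s ^ j / fact j) sums exp s"
    using exp_converges[of s] by (simp add: field_simps)
  then show ?thesis
    using assms sum_le_suminf[of "\<lambda>j. s ^ j / fact j" A] by (simp add: sums_iff)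
qed

text \<open>Majorization of power series. It forces the coefficients of \<open>P\<close> to be
  nonnegative, hence is stable under products, and it allows the unknown values of \<open>g\<close>
  to be replaced by 1 when coefficients are estimated.\<close>

definition coeffwise_le :: "real poly \<Rightarrow> real poly \<Rightarrow> bool" where
  "coeffwise_le p P \<longleftrightarrow> (\<forall>i. \<bar>coeff p i\<bar> \<le> coeff P i)"

lemma coeffwise_le_add:
  "coeffwise_le p P \<Longrightarrow> coeffwise_le q Q \<Longrightarrow> coeffwise_le (p + q) (P + Q)"
  unfolding coeffwise_le_def by (metis abs_triangle_ineq add_mono coeff_add order_trans)

lemma coeffwise_le_0: "coeffwise_le 0 0"
  by (simp add: coeffwise_le_def)

lemma coeffwise_le_sum:
  "(\<And>x. x \<in> A \<Longrightarrow> coeffwise_le (p x) (P x)) \<Longrightarrow> coeffwise_le (sum p A) (sum P A)"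
  by (induction A rule: infinite_finite_induct) (auto intro: coeffwise_le_add coeffwise_le_0)

lemma coeffwise_le_mult:
  assumes "coeffwise_le p P" "coeffwise_le q Q"
  shows "coeffwise_le (p * q) (P * Q)"
  unfolding coeffwise_le_def
proof
  fix i
  have "\<bar>coeff (p * q) i\<bar> \<le> (\<Sum>j\<le>i. \<bar>coeff p j * coeff q (i - j)\<bar>)"
    unfolding coeff_mult by (rule sum_abs)
  also have "\<dots> \<le> (\<Sum>j\<le>i. coeff P j * coeff Q (i - j))"
    unfolding abs_mult using assms unfolding coeffwise_le_def
    by (intro sum_mono mult_mono) (auto intro: order_trans[OF abs_ge_zero])
  finally show "\<bar>coeff (p * q) i\<bar> \<le> coeff (P * Q) i" by (simp add: coeff_mult)
qed

lemma coeffwise_le_const: "\<bar>a\<bar> \<le> b \<Longrightarrow> coeffwise_le [:a:] [:b:]"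
  by (auto simp: coeffwise_le_def coeff_pCons split: nat.split)

lemma coeffwise_le_prod:
  "(\<And>x. x \<in> A \<Longrightarrow> coeffwise_le (p x) (P x)) \<Longrightarrow> coeffwise_le (prod p A) (prod P A)"
  by (induction A rule: infinite_finite_induct)
    (auto intro: coeffwise_le_mult simp: coeffwise_le_const[of 1 1, unfolded one_pCons[symmetric]])

lemma coeffwise_le_power: "coeffwise_le p P \<Longrightarrow> coeffwise_le (p ^ n) (P ^ n)"
  using coeffwise_le_prod[of "{..<n}" "\<lambda>_. p" "\<lambda>_. P"] by simp

text \<open>For weights of total 1, the mean of \<open>g\<close> over \<open>q\<close> independent
  indices drawn from \<open>y\<close>. Unnormalized weights are allowed so that it becomes a
  homogeneous polynomial of degree \<open>q\<close> in the weights.\<close>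

definition sample_mean :: "nat \<Rightarrow> nat \<Rightarrow> ((nat \<Rightarrow> nat) \<Rightarrow> real) \<Rightarrow> (nat \<Rightarrow> real) \<Rightarrow> real" where
  "sample_mean N q g y = (\<Sum>x\<in>PiE {..<q} (\<lambda>_. {..<N}). (\<Prod>i<q. y (x i)) * g x)"

lemma sample_mean_divide: "sample_mean N q g (\<lambda>i. y i / s) = sample_mean N q g y / s ^ q"
  unfolding sample_mean_def sum_divide_distrib by (simp add: prod_dividef)

lemma sample_mean_nonneg:
  "(\<And>i. i < N \<Longrightarrow> 0 \<le> y i) \<Longrightarrow> (\<And>x. 0 \<le> g x) \<Longrightarrow> 0 \<le> sample_mean N q g y"
  unfolding sample_mean_def by (intro sum_nonneg mult_nonneg_nonneg prod_nonneg) (auto simp: PiE_iff)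

lemma sample_mean_le:
  assumes "\<And>i. i < N \<Longrightarrow> 0 \<le> y i" "\<And>x. g x \<le> 1"
  shows "sample_mean N q g y \<le> (\<Sum>i<N. y i) ^ q"
proof -
  have "sample_mean N q g y \<le> (\<Sum>x\<in>PiE {..<q} (\<lambda>_. {..<N}). (\<Prod>i<q. y (x i)))"
    unfolding sample_mean_def using assms by (intro sum_mono mult_left_le prod_nonneg) (auto simp: PiE_iff)
  also have "\<dots> = (\<Sum>i<N. y i) ^ q"
    using prod_sum_PiE[of "{..<q}" "\<lambda>_. {..<N}" "\<lambda>_. y"] by simp
  finally show ?thesis .
qed

text \<open>With \<open>s = \<Sum>i<N. y i\<close>, this equals the probability that a Poisson variable of mean \<open>s\<close> lies in
  \<open>{q..K}\<close>, times the mean of \<open>g\<close> on \<open>q\<close> samples from \<open>y / s\<close>. Independent Poisson counts make it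
  an \<open>exp (- u)\<close> times a well-bounded power series in each coordinate \<open>u\<close>.\<close>

definition poissonized :: "nat \<Rightarrow> nat \<Rightarrow> nat \<Rightarrow> ((nat \<Rightarrow> nat) \<Rightarrow> real) \<Rightarrow> (nat \<Rightarrow> real) \<Rightarrow> real" where
  "poissonized N q K g y = exp (- (\<Sum>i<N. y i)) *
     (\<Sum>M=q..K. (\<Sum>i<N. y i) ^ (M - q) * sample_mean N q g y / fact M)"

text \<open>By homogeneity, normalizing the weights releases a factor \<open>s ^ q\<close>, which
  completes \<open>s ^ (M - q)\<close> to the Poisson term \<open>s ^ M\<close>. This is why the sum
  starts at \<open>M = q\<close>.\<close>

lemma poissonized_eq:
  assumes "(\<Sum>i<N. y i) > 0"
  shows "poissonized N q K g y = sample_mean N q g (\<lambda>i. y i / (\<Sum>i<N. y i)) *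
    (exp (- (\<Sum>i<N. y i)) * (\<Sum>M=q..K. (\<Sum>i<N. y i) ^ M / fact M))"
proof -
  define s where "s = (\<Sum>i<N. y i)"
  have "s ^ (M - q) * sample_mean N q g y / fact M =
      sample_mean N q g (\<lambda>i. y i / s) * (s ^ M / fact M)" if "M \<in> {q..K}" for M
    using that assms unfolding sample_mean_divide by (simp add: power_diff s_def[symmetric])
  then have "(\<Sum>M=q..K. s ^ (M - q) * sample_mean N q g y / fact M) =
      sample_mean N q g (\<lambda>i. y i / s) * (\<Sum>M=q..K. s ^ M / fact M)"
    unfolding sum_distrib_left by (intro sum.cong) auto
  then show ?thesis unfolding poissonized_def s_def[symmetric] by simp
qed

text \<open>Let \<open>s\<close> be the total of the other weights. Replacing \<open>g\<close> by 1
  majorizes the sample mean by \<open>(s + u) ^ q\<close>, hence the whole sum by a part of the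
  exponential series at \<open>s + u\<close>. The coefficient of \<open>u ^ c\<close> there is at
  most \<open>exp s / fact c\<close>, and the factor \<open>exp (- s)\<close> cancels
  \<open>exp s\<close>.\<close>

lemma poissonized_coordinate:
  assumes t: "t < N" and y: "\<And>i. i < N \<Longrightarrow> i \<noteq> t \<Longrightarrow> 0 \<le> y i" and g: "\<And>x. \<bar>g x\<bar> \<le> 1"
  obtains Q where "\<And>u. poissonized N q K g (y(t := u)) = exp (- u) * poly Q u"
    "\<And>c. \<bar>coeff Q c\<bar> \<le> 1 / fact c"
proof -
  define s where "s = (\<Sum>i\<in>{..<N} - {t}. y i)"
  have s: "s \<ge> 0" unfolding s_def using y by (intro sum_nonneg) auto
  define L where "L = [:s, 1:]"
  define f where "f i = (if i = t then [:0, 1:] else [:y i:])" for i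
  define A where "A = (\<Sum>x\<in>PiE {..<q} (\<lambda>_. {..<N}). (\<Prod>i<q. f (x i)) * [:g x:])"
  have N: "{..<N} = insert t ({..<N} - {t})" using t by auto
  have sum_f: "(\<Sum>i<N. f i) = L"
  proof -
    have "(\<Sum>i\<in>{..<N} - {t}. f i) = (\<Sum>i\<in>{..<N} - {t}. [:y i:])"
      by (intro sum.cong) (auto simp: f_def)
    also have "\<dots> = [:s:]" unfolding s_def by (induction rule: infinite_finite_induct) auto
    finally show ?thesis by (subst N, subst sum.insert) (auto simp: f_def L_def)
  qed
  have sum_y: "(\<Sum>i<N. (y(t := u)) i) = s + u" for u
    by (subst N, subst sum.insert) (auto simp: s_def intro!: sum.cong)
  have poly_f: "poly (f i) u = (y(t := u)) i" for i u by (simp add: f_def)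
  have poly_A: "poly A u = sample_mean N q g (y(t := u))" for u
    by (simp only: A_def sample_mean_def poly_sum poly_mult poly_prod poly_f) simp
  have f: "coeffwise_le (f i) (f i)" if "i < N" for i
    using y[OF that] by (auto simp: f_def coeffwise_le_def coeff_pCons split: nat.split)
  have "coeffwise_le A (\<Sum>x\<in>PiE {..<q} (\<lambda>_. {..<N}). (\<Prod>i<q. f (x i)) * [:1:])"
    unfolding A_def
    by (intro coeffwise_le_sum coeffwise_le_mult coeffwise_le_prod f coeffwise_le_const g) (auto simp: PiE_iff)
  also have "(\<Sum>x\<in>PiE {..<q} (\<lambda>_. {..<N}). (\<Prod>i<q. f (x i)) * [:1:]) = L ^ q"
    using prod_sum_PiE[of "{..<q}" "\<lambda>_. {..<N}" "\<lambda>_. f"] by (simp add: sum_f flip: one_pCons)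
  finally have A: "coeffwise_le A (L ^ q)" .
  have L: "coeffwise_le L L" using s by (auto simp: L_def coeffwise_le_def coeff_pCons split: nat.split)
  define B where "B = (\<Sum>M=q..K. L ^ (M - q) * A * [:1 / fact M:])"
  have "coeffwise_le B (\<Sum>M=q..K. L ^ (M - q) * L ^ q * [:1 / fact M:])"
    unfolding B_def by (intro coeffwise_le_sum coeffwise_le_mult coeffwise_le_power A L coeffwise_le_const) simp
  also have "(\<Sum>M=q..K. L ^ (M - q) * L ^ q * [:1 / fact M:]) = (\<Sum>M=q..K. smult (1 / fact M) (L ^ M))"
    by (intro sum.cong refl) (auto simp flip: power_add)
  finally have B: "\<bar>coeff B c\<bar> \<le> (\<Sum>M=q..K. coeff (L ^ M) c / fact M)" for c
    by (simp add: coeffwise_le_def coeff_sum)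
  have B': "\<bar>coeff B c\<bar> \<le> exp s / fact c" for c
  proof -
    have coef: "coeff (L ^ M) c / fact M = s ^ (M - c) / fact (M - c) / fact c" if "c \<le> M" for M
      using that by (simp add: L_def coeff_linear_poly_power binomial_fact)
    have "coeff (L ^ M) c = 0" if "M < c" for M
      using that by (intro coeff_eq_0) (simp add: L_def degree_power_eq)
    then have "(\<Sum>M=q..K. coeff (L ^ M) c / fact M) = (\<Sum>M\<in>{q..K} \<inter> {c..}. coeff (L ^ M) c / fact M)"
      by (intro sum.mono_neutral_right) auto
    also have "\<dots> \<le> (\<Sum>j\<le>K. s ^ j / fact j / fact c)"
      by (rule sum_le_included[where i = "\<lambda>j. c + j"])
        (use s coef in \<open>auto intro!: bexI[of _ "_ - c"]\<close>)
    also have "\<dots> \<le> exp s / fact c"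
      unfolding sum_divide_distrib[symmetric] by (intro divide_right_mono sum_le_exp s) auto
    finally show ?thesis using B[of c] by linarith
  qed
  show ?thesis
  proof (rule that[of "smult (exp (- s)) B"])
    fix u
    have "poly B u = (\<Sum>M=q..K. (s + u) ^ (M - q) * sample_mean N q g (y(t := u)) / fact M)"
      by (simp add: B_def poly_sum poly_mult poly_A L_def)
    then show "poissonized N q K g (y(t := u)) = exp (- u) * poly (smult (exp (- s)) B) u"
      unfolding poissonized_def sum_y by (simp add: mult_exp_exp)
  next
    fix c
    show "\<bar>coeff (smult (exp (- s)) B) c\<bar> \<le> 1 / fact c"
      using mult_left_mono[OF B'[of c], of "exp (- s)"] by (simp add: abs_mult exp_minus field_simps)
  qed
qed

section \<open>Indistinguishability of support sizes\<close>

text \<open>Chernoff-type bounds. Below \<open>q\<close>, comparison with the series at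
  \<open>s / 2\<close> costs \<open>2 ^ q\<close> and gives at most \<open>exp (3 * s / 4)\<close>.
  Beyond \<open>K\<close>, comparison with the series at \<open>2 * s\<close> gains
  \<open>2 ^ (K + 1)\<close>, which exceeds \<open>exp (3 * s)\<close> because \<open>K\<close> is
  at least \<open>5 * s\<close>.\<close>

lemma poisson_middle_ge:
  fixes s :: real
  assumes s: "0 \<le> s" "4 * real q \<le> s" and K: "5 * s \<le> real K"
  shows "1 - 2 * exp (- (s / 4)) \<le> exp (- s) * (\<Sum>M=q..K. s ^ M / fact M)"
proof -
  have "(\<Sum>M<q. s ^ M / fact M) \<le> (\<Sum>M<q. 2 ^ q * ((s / 2) ^ M / fact M))"
  proof (rule sum_mono)
    fix M assume "M \<in> {..<q}"
    then have "(2::real) ^ M \<le> 2 ^ q" by (intro power_increasing) auto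
    then have "2 ^ M * ((s / 2) ^ M / fact M) \<le> 2 ^ q * ((s / 2) ^ M / fact M)"
      using s by (intro mult_right_mono) auto
    then show "s ^ M / fact M \<le> 2 ^ q * ((s / 2) ^ M / fact M)"
      by (simp add: power_divide)
  qed
  also have "\<dots> \<le> 2 ^ q * exp (s / 2)"
    unfolding sum_distrib_left[symmetric] using s by (intro mult_left_mono sum_le_exp) auto
  also have "(2::real) ^ q \<le> exp 1 ^ q"
    using exp_ge_add_one_self[of 1] by (intro power_mono) auto
  also have "exp 1 ^ q = exp (real q)" by (simp flip: exp_of_nat_mult)
  also have "\<dots> \<le> exp (s / 4)" using s by simp
  also have "exp (s / 4) * exp (s / 2) = exp s * exp (- (s / 4))" by (simp flip: exp_add)
  finally have lower: "(\<Sum>M<q. s ^ M / fact M) \<le> exp s * exp (- (s / 4))" by simp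
  define n where "n = Suc K"
  have "s ^ n / fact n * exp s \<le> exp (2 * s) / 2 ^ n * exp s"
    using sum_le_exp[of "2 * s" "{n}"] s by (intro mult_right_mono) (simp_all add: field_simps)
  also have "\<dots> = exp (3 * s) / 2 ^ n" by (simp flip: exp_add)
  also have "\<dots> \<le> 1"
  proof -
    have "3 * s \<le> real n * (2/3)" using K s by (simp add: n_def)
    also have "\<dots> \<le> real n * ln 2" using ln2_ge_two_thirds by (intro mult_left_mono) auto
    finally have "exp (3 * s) \<le> exp (real n * ln 2)" by simp
    also have "\<dots> = 2 ^ n" by (simp add: exp_of_nat_mult)
    finally show ?thesis by simp
  qed
  also have "1 \<le> exp s * exp (- (s / 4))" using s by (simp flip: exp_add)
  finally have upper: "s ^ n / fact n * exp s \<le> exp s * exp (- (s / 4))" .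
  have "(\<lambda>j. s ^ j / fact j) sums exp s"
    using exp_converges[of s] by (simp add: field_simps)
  then have "exp s = (\<Sum>j. s ^ (j + n) / fact (j + n)) + (\<Sum>j<n. s ^ j / fact j)"
    using suminf_split_initial_segment[of "\<lambda>j. s ^ j / fact j" n] by (simp add: sums_iff)
  moreover have "(\<Sum>j<n. s ^ j / fact j) = (\<Sum>M<q. s ^ M / fact M) + (\<Sum>M=q..K. s ^ M / fact M)"
  proof -
    have "real q \<le> real K" using s K by linarith
    then have "{..<n} = {..<q} \<union> {q..K}" "{..<q} \<inter> {q..K} = {}" by (auto simp: n_def)
    then show ?thesis by (simp add: sum.union_disjoint)
  qed
  moreover have "(\<Sum>j. s ^ (j + n) / fact (j + n)) \<le> s ^ n / fact n * exp s"
    using s(1) by (rule exp_tail_le)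
  ultimately have "exp s - 2 * (exp s * exp (- (s / 4))) \<le> (\<Sum>M=q..K. s ^ M / fact M)"
    using lower upper by linarith
  from mult_left_mono[OF this, of "exp (- s)"]
  have "exp (- s) * exp s * (1 - 2 * exp (- (s / 4))) \<le> exp (- s) * (\<Sum>M=q..K. s ^ M / fact M)"
    by (simp only: mult.assoc right_diff_distrib mult_1_right mult.left_commute[of _ 2] exp_ge_zero)
  then show ?thesis by (simp flip: exp_add)
qed

lemma poisson_middle_le:
  fixes s :: real
  assumes "0 \<le> s"
  shows "exp (- s) * (\<Sum>M=q..K. s ^ M / fact M) \<le> 1"
  using mult_left_mono[OF sum_le_exp[OF assms, of "{q..K}"], of "exp (- s)"] by (simp add: exp_minus)

text \<open>If \<open>q\<close> were small, the Poissonized acceptance probability would average to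
  at least \<open>5/8 - 1/500\<close> over weights from \<open>p0\<close> and to at most
  \<open>1/3 + 1/1000\<close> over weights from \<open>p1\<close>, while exchanging all
  \<open>N\<close> coordinates moves the average by at most \<open>1/64\<close>.\<close>

theorem support_size_lower_bound:
  fixes N q r m :: nat and g :: "(nat \<Rightarrow> nat) \<Rightarrow> real"
  assumes N: "N = 8 * r" "N \<le> 2 ^ m" "2 ^ 18 * m\<^sup>2 \<le> N" and m: "m \<ge> 1"
    and g: "\<And>x. 0 \<le> g x" "\<And>x. g x \<le> 1"
    and small: "\<And>w. \<lbrakk>\<And>i. i < N \<Longrightarrow> 0 \<le> w i; (\<Sum>i<N. w i) = 1; card {i. i < N \<and> w i \<noteq> 0} \<le> 7 * r\<rbrakk>
      \<Longrightarrow> 2/3 \<le> sample_mean N q g w"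
    and large: "\<And>w. \<lbrakk>\<And>i. i < N \<Longrightarrow> 1 / (256 * real N) \<le> w i; (\<Sum>i<N. w i) = 1\<rbrakk>
      \<Longrightarrow> sample_mean N q g w \<le> 1/3"
  shows "real N < 8192 * real m * real q"
proof (rule ccontr)
  assume "\<not> real N < 8192 * real m * real q"
  then have q: "8192 * real m * real q \<le> real N" by simp
  have m0: "real m \<ge> 1" using m by simp
  have "real (2 ^ 18 * m\<^sup>2) \<le> real N" using N(3) of_nat_mono by blast
  then have Nm: "262144 * (real m)\<^sup>2 \<le> real N" by simp
  have "real m * 1 \<le> (real m)\<^sup>2" unfolding power2_eq_square using m0 by (intro mult_left_mono) auto
  then have Nm1: "262144 * real m \<le> real N" using Nm by linarith
  have N0: "real N > 0" using Nm1 m0 by simp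
  obtain p0 p1 :: "real pmf" where fin: "finite (set_pmf p0)" "finite (set_pmf p1)"
    and supp: "set_pmf p0 \<subseteq> {0..16 * (real m)\<^sup>2}" "set_pmf p1 \<subseteq> {1..16 * (real m)\<^sup>2}"
    and p0_0: "pmf p0 0 \<ge> 1/4"
    and moments: "\<And>d. d \<le> 2 * m \<Longrightarrow>
      measure_pmf.expectation p0 (\<lambda>x. x ^ d) = measure_pmf.expectation p1 (\<lambda>x. x ^ d)"
    and mean: "measure_pmf.expectation p0 (\<lambda>x. x) \<le> 128"
    using matched_moments_pair[OF m] by blast
  define \<mu> where "\<mu> = measure_pmf.expectation p0 (\<lambda>x. x)"
  have \<mu>1: "\<mu> = measure_pmf.expectation p1 (\<lambda>x. x)"
    using moments[of 1] m by (simp add: \<mu>_def)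
  have "1 \<le> \<mu>" unfolding \<mu>1 using fin supp
    by (intro measure_pmf.integral_ge_const integrable_measure_pmf_finite) (auto simp: AE_measure_pmf_iff)
  have "\<mu> \<le> 128" using mean by (simp add: \<mu>_def)
  define prior where "prior p = Pi_pmf {..<N} (0::real) (\<lambda>_. p)" for p
  have fin_prior: "finite (set_pmf (prior p0))" "finite (set_pmf (prior p1))"
    unfolding prior_def using fin by (auto intro!: finite_set_Pi_pmf)
  have supp_prior: "f i \<in> set_pmf p" if "f \<in> set_pmf (prior p)" "i < N" for f p i
    using that set_Pi_pmf_subset'[of "{..<N}" "0::real" "\<lambda>_. p"] by (auto simp: prior_def PiE_dflt_def)

  \<comment> \<open>Values in \<open>[0, 16 * m^2]\<close> have second moment at most
    \<open>16 * m^2\<close> times their mean, so the variance bound is linear in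
    \<open>\<mu>\<close>. Chebyshev then works as soon as \<open>N\<close> is a large multiple of
    \<open>m^2\<close>.\<close>
  have conc: "measure (prior p) {f. \<bar>\<Sum>i<N. f i - \<mu>\<bar> \<ge> real N * \<mu> / 2} \<le> 64 * (real m)\<^sup>2 / real N"
    if p: "finite (set_pmf p)" "set_pmf p \<subseteq> {0..16 * (real m)\<^sup>2}" "measure_pmf.expectation p (\<lambda>x. x) = \<mu>" for p
  proof -
    have int: "integrable (measure_pmf p) h" for h :: "real \<Rightarrow> real"
      using p(1) by (intro integrable_measure_pmf_finite)
    have "measure_pmf.expectation p (\<lambda>u. (u - \<mu>)\<^sup>2) = measure_pmf.expectation p (\<lambda>u. u\<^sup>2) - \<mu>\<^sup>2"
      using p(3) by (simp add: power2_diff int) (simp add: power2_eq_square mult.commute)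
    also have "\<dots> \<le> measure_pmf.expectation p (\<lambda>u. u\<^sup>2)" by simp
    also have "\<dots> \<le> measure_pmf.expectation p (\<lambda>u. 16 * (real m)\<^sup>2 * u)"
      unfolding power2_eq_square[of "_ :: real"] using p(2)
      by (intro integral_mono_AE int) (auto simp: AE_measure_pmf_iff power2_eq_square intro!: mult_right_mono)
    also have "\<dots> = 16 * (real m)\<^sup>2 * \<mu>" using p(3) by simp
    finally have var: "measure_pmf.expectation p (\<lambda>u. (u - \<mu>)\<^sup>2) \<le> 16 * (real m)\<^sup>2 * \<mu>" .
    have "measure (prior p) {f. \<bar>\<Sum>i<N. f i - \<mu>\<bar> \<ge> real N * \<mu> / 2}
        \<le> real (card {..<N}) * measure_pmf.expectation p (\<lambda>u. (u - \<mu>)\<^sup>2) / (real N * \<mu> / 2)\<^sup>2"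
      unfolding prior_def using p N0 \<open>1 \<le> \<mu>\<close>
      by (intro Chebyshev_Pi_pmf) (auto simp: int)
    also have "\<dots> \<le> real (card {..<N}) * (16 * (real m)\<^sup>2 * \<mu>) / (real N * \<mu> / 2)\<^sup>2"
      by (intro divide_right_mono mult_left_mono var) auto
    also have "\<dots> = (64 * (real m)\<^sup>2 / real N) / \<mu>"
      using N0 \<open>1 \<le> \<mu>\<close> by (simp add: field_simps power2_eq_square)
    also have "\<dots> \<le> 64 * (real m)\<^sup>2 / real N"
      using divide_left_mono[of 1 \<mu> "64 * (real m)\<^sup>2 / real N"] \<open>1 \<le> \<mu>\<close> by simp
    finally show ?thesis .
  qed
  have small_tail: "64 * (real m)\<^sup>2 / real N \<le> 1/1000"
    using Nm N0 by (simp add: field_simps)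

  define h where "h u = indicator {0} u - pmf p0 0" for u :: real
  have zeros: "measure (prior p0) {f. \<bar>\<Sum>i<N. h (f i)\<bar> \<ge> real N / 8} \<le> 1/1000"
  proof -
    have int: "integrable (measure_pmf p0) h" for h :: "real \<Rightarrow> real"
      using fin by (intro integrable_measure_pmf_finite)
    have "measure_pmf.expectation p0 h = measure p0 {0} - pmf p0 0"
      unfolding h_def by (simp add: int)
    then have h0: "measure_pmf.expectation p0 h = 0" by (simp add: pmf.rep_eq)
    have "\<bar>h u\<bar> \<le> 1" for u
      using pmf_le_1[of p0 0] pmf_nonneg[of p0 0] by (simp add: h_def indicator_def)
    then have "measure_pmf.expectation p0 (\<lambda>u. (h u)\<^sup>2) \<le> 1"
      by (intro measure_pmf.integral_le_const int) (simp add: abs_square_le_1)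
    then have "real (card {..<N}) * measure_pmf.expectation p0 (\<lambda>u. (h u)\<^sup>2) / (real N / 8)\<^sup>2
        \<le> real (card {..<N}) * 1 / (real N / 8)\<^sup>2"
      by (intro divide_right_mono mult_left_mono) auto
    also have "\<dots> = 64 / real N" using N0 by (simp add: field_simps power2_eq_square)
    also have "\<dots> \<le> 1/1000" using Nm1 m0 N0 by (simp add: field_simps)
    finally have var: "real (card {..<N}) * measure_pmf.expectation p0 (\<lambda>u. (h u)\<^sup>2) / (real N / 8)\<^sup>2 \<le> 1/1000" .
    have "measure (prior p0) {f. \<bar>\<Sum>i<N. h (f i)\<bar> \<ge> real N / 8}
        \<le> real (card {..<N}) * measure_pmf.expectation p0 (\<lambda>u. (h u)\<^sup>2) / (real N / 8)\<^sup>2"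
      unfolding prior_def using fin h0 N0 by (intro Chebyshev_Pi_pmf) auto
    then show ?thesis using var by (rule order_trans)
  qed

  \<comment> \<open>Every single rate is at most \<open>16 * m^2 * lam = m / 64\<close>, small
    enough for the Taylor remainder. The total rate is typically at least
    \<open>lam * N / 2 = N / (2048 * m)\<close>, and requiring this to be at least
    \<open>4 * q\<close> yields the constant 8192.\<close>
  define lam where "lam = 1 / (1024 * real m)"
  have lam: "lam > 0" using m0 by (simp add: lam_def)
  \<comment> \<open>At least five times every possible total rate: \<open>lam * T\<close> never
    exceeds \<open>N * m / 64\<close>.\<close>
  define K where "K = 5 * N * m"
  define \<Phi> where "\<Phi> f = poissonized N q K g (\<lambda>i. lam * f i)" for f
  have \<Phi>_eq: "\<Phi> f = sample_mean N q g (\<lambda>i. f i / (\<Sum>i<N. f i)) *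
      (exp (- (lam * (\<Sum>i<N. f i))) * (\<Sum>M=q..K. (lam * (\<Sum>i<N. f i)) ^ M / fact M))"
    if "(\<Sum>i<N. f i) > 0" for f
    using poissonized_eq[of "\<lambda>i. lam * f i" N q K g] lam that
    by (simp add: \<Phi>_def flip: sum_distrib_left)

  \<comment> \<open>\<open>5/8\<close> is \<open>2/3 * 15/16\<close>: the acceptance guarantee times
    the Poisson mass of \<open>{q..K}\<close>.\<close>
  have lower: "5/8 \<le> \<Phi> f" if f: "f \<in> set_pmf (prior p0)"
    "\<bar>\<Sum>i<N. f i - \<mu>\<bar> < real N * \<mu> / 2" "\<bar>\<Sum>i<N. h (f i)\<bar> < real N / 8" for f
  proof -
    define T where "T = (\<Sum>i<N. f i)"
    have f0: "0 \<le> f i" "f i \<le> 16 * (real m)\<^sup>2" if "i < N" for i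
      using supp_prior[OF f(1) that] supp by auto
    have "real N * 1 \<le> real N * \<mu>" using \<open>1 \<le> \<mu>\<close> by (intro mult_left_mono) auto
    moreover have "\<bar>T - real N * \<mu>\<bar> < real N * \<mu> / 2" using f(2) by (simp add: T_def sum_subtractf)
    ultimately have T: "T \<ge> real N / 2" by linarith
    have T0: "T > 0" using T N0 by linarith
    have "T \<le> real N * (16 * (real m)\<^sup>2)"
      unfolding T_def using sum_bounded_above[of "{..<N}" f] f0 by simp
    then have Tu: "lam * T \<le> lam * (real N * (16 * (real m)\<^sup>2))" using lam by simp
    have "2/3 \<le> sample_mean N q g (\<lambda>i. f i / T)"
    proof (rule small)
      show "0 \<le> f i / T" if "i < N" for i using f0 that T0 by simp
      show "(\<Sum>i<N. f i / T) = 1" using T0 by (simp add: T_def flip: sum_divide_distrib)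
      \<comment> \<open>On average at least a quarter of the weights vanish, and the deviation is
        below \<open>N / 8\<close>; so at least \<open>N / 8 = r\<close> of them do.\<close>
      have "{..<N} \<inter> {i. f i = 0} = {i. i < N \<and> f i = 0}" by auto
      then have "(\<Sum>i<N. h (f i)) = real (card {i. i < N \<and> f i = 0}) - real N * pmf p0 0"
        by (simp add: h_def sum_subtractf indicator_def)
      then have "real (card {i. i < N \<and> f i = 0}) \<ge> real N * pmf p0 0 - real N / 8"
        using f(3) by linarith
      moreover have "real N * pmf p0 0 \<ge> real N * (1/4)" using p0_0 by (intro mult_left_mono) auto
      ultimately have "real r \<le> real (card {i. i < N \<and> f i = 0})" using N by simp
      moreover have "card {i. i < N \<and> f i = 0} + card {i. i < N \<and> f i \<noteq> 0} = card {..<N}"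
        by (subst card_Un_disjoint[symmetric]) (auto intro!: arg_cong[of _ "{..<N}" card] simp del: card_lessThan)
      ultimately have "card {i. i < N \<and> f i \<noteq> 0} \<le> 7 * r" using N by simp
      then show "card {i. i < N \<and> f i / T \<noteq> 0} \<le> 7 * r" using T0 by simp
    qed
    moreover have "15/16 \<le> exp (- (lam * T)) * (\<Sum>M=q..K. (lam * T) ^ M / fact M)"
    proof -
      have "lam * (real N / 2) \<le> lam * T" using T lam by (intro mult_left_mono) auto
      then have lT: "real N / (2048 * real m) \<le> lam * T" by (simp add: lam_def)
      have "128 \<le> real N / (2048 * real m)" using Nm1 m0 by (simp add: field_simps)
      then have "33 \<le> exp (lam * T / 4)" using exp_ge_add_one_self[of "lam * T / 4"] lT by linarith
      then have "exp (- (lam * T / 4)) \<le> 1/33" by (simp add: exp_minus field_simps)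
      moreover have "1 - 2 * exp (- (lam * T / 4)) \<le> exp (- (lam * T)) * (\<Sum>M=q..K. (lam * T) ^ M / fact M)"
      proof (rule poisson_middle_ge)
        show "0 \<le> lam * T" using lam T0 by simp
        have "4 * real q \<le> real N / (2048 * real m)" using q m0 by (simp add: field_simps)
        then show "4 * real q \<le> lam * T" using lT by linarith
        have "lam * (real N * (16 * (real m)\<^sup>2)) \<le> real N * real m"
          using m0 by (simp add: lam_def field_simps power2_eq_square)
        then show "5 * (lam * T) \<le> real K" using Tu by (simp add: K_def)
      qed
      ultimately show ?thesis by linarith
    qed
    ultimately have "2/3 * (15/16) \<le> \<Phi> f"
      unfolding \<Phi>_eq[OF T0[unfolded T_def]] T_def[symmetric] by (intro mult_mono) auto
    then show ?thesis by simp
  qed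

  \<comment> \<open>Weights from \<open>p1\<close> are at least 1, and concentration keeps their
    total below \<open>3/2 * 128 * N\<close>, hence below \<open>256 * N\<close>.\<close>
  have upper: "\<Phi> f \<le> 1/3" if f: "f \<in> set_pmf (prior p1)" "\<bar>\<Sum>i<N. f i - \<mu>\<bar> < real N * \<mu> / 2" for f
  proof -
    define T where "T = (\<Sum>i<N. f i)"
    have f1: "1 \<le> f i" if "i < N" for i
      using supp_prior[OF f(1) that] supp by auto
    have "\<bar>T - real N * \<mu>\<bar> < real N * \<mu> / 2" using f(2) by (simp add: T_def sum_subtractf)
    moreover have "real N * \<mu> \<le> real N * 128" using \<open>\<mu> \<le> 128\<close> by (intro mult_left_mono) auto
    ultimately have Tu: "T \<le> 256 * real N" by linarith
    have "real N * 1 \<le> T" unfolding T_def using f1 sum_bounded_below[of "{..<N}" 1 f] by simp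
    then have T0: "T > 0" using N0 by linarith
    have "sample_mean N q g (\<lambda>i. f i / T) \<le> 1/3"
    proof (rule large)
      show "1 / (256 * real N) \<le> f i / T" if "i < N" for i
        using f1[OF that] Tu T0 by (intro frac_le) auto
      show "(\<Sum>i<N. f i / T) = 1" using T0 by (simp add: T_def flip: sum_divide_distrib)
    qed
    moreover have "0 \<le> sample_mean N q g (\<lambda>i. f i / T)"
      using f1 T0 g by (intro sample_mean_nonneg divide_nonneg_pos) (auto intro: order_trans[OF zero_le_one])
    moreover have "exp (- (lam * T)) * (\<Sum>M=q..K. (lam * T) ^ M / fact M) \<le> 1"
      using lam T0 by (intro poisson_middle_le) simp
    ultimately have "\<Phi> f \<le> 1/3 * 1"
      unfolding \<Phi>_eq[OF T0[unfolded T_def]] T_def[symmetric] using lam T0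
      by (intro mult_mono) (auto intro!: mult_nonneg_nonneg sum_nonneg)
    then show ?thesis by simp
  qed

  have \<Phi>_bounds: "0 \<le> \<Phi> f" "\<Phi> f \<le> 1" if f: "\<And>i. i < N \<Longrightarrow> 0 \<le> f i" for f
  proof -
    have 0: "0 \<le> (\<Sum>i<N. lam * f i)" using lam f by (intro sum_nonneg) auto
    have A: "0 \<le> sample_mean N q g (\<lambda>i. lam * f i)" using lam f g by (intro sample_mean_nonneg) auto
    show "0 \<le> \<Phi> f" unfolding \<Phi>_def poissonized_def using 0 A
      by (intro mult_nonneg_nonneg sum_nonneg divide_nonneg_pos) auto
    have A': "sample_mean N q g (\<lambda>i. lam * f i) \<le> (\<Sum>i<N. lam * f i) ^ q"
      using lam f g by (intro sample_mean_le) auto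
    have "\<Phi> f \<le> exp (- (\<Sum>i<N. lam * f i)) * (\<Sum>M=q..K. (\<Sum>i<N. lam * f i) ^ (M - q) * (\<Sum>i<N. lam * f i) ^ q / fact M)"
      unfolding \<Phi>_def poissonized_def using 0 A'
      by (intro mult_left_mono sum_mono divide_right_mono) auto
    also have "\<dots> = exp (- (\<Sum>i<N. lam * f i)) * (\<Sum>M=q..K. (\<Sum>i<N. lam * f i) ^ M / fact M)"
      by (intro arg_cong2[of _ _ _ _ "(*)"] sum.cong refl) (auto simp flip: power_add)
    also have "\<dots> \<le> 1" using 0 by (rule poisson_middle_le)
    finally show "\<Phi> f \<le> 1" .
  qed

  define bad where "bad = {f. \<bar>\<Sum>i<N. f i - \<mu>\<bar> \<ge> real N * \<mu> / 2}"
  define bad' where "bad' = {f. \<bar>\<Sum>i<N. h (f i)\<bar> \<ge> real N / 8}"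
  have int: "integrable (measure_pmf (prior p0)) F" "integrable (measure_pmf (prior p1)) F"
    for F :: "(nat \<Rightarrow> real) \<Rightarrow> real"
    using fin_prior by (auto intro: integrable_measure_pmf_finite)
  have "5/8 - 1/500 \<le> measure_pmf.expectation (prior p0) \<Phi>"
  proof -
    have "measure_pmf.expectation (prior p0) (\<lambda>f. 5/8 - indicator bad f - indicator bad' f)
        \<le> measure_pmf.expectation (prior p0) \<Phi>"
    proof (rule integral_mono_AE[OF int(1) int(1)], unfold AE_measure_pmf_iff, intro ballI)
      fix f assume f: "f \<in> set_pmf (prior p0)"
      have "0 \<le> f i" if "i < N" for i using supp_prior[OF f that] supp(1) by auto
      then have "0 \<le> \<Phi> f" by (rule \<Phi>_bounds)
      then show "5/8 - indicator bad f - indicator bad' f \<le> \<Phi> f"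
        using lower[OF f] by (auto simp: bad_def bad'_def indicator_def not_le)
    qed
    moreover have "measure_pmf.expectation (prior p0) (\<lambda>f. 5/8 - indicator bad f - indicator bad' f) =
        5/8 - measure (prior p0) bad - measure (prior p0) bad'"
      by (simp add: int)
    moreover have "measure (prior p0) bad \<le> 1/1000"
      using conc[of p0] fin supp small_tail by (simp add: bad_def \<mu>_def)
    moreover have "measure (prior p0) bad' \<le> 1/1000" using zeros by (simp add: bad'_def)
    ultimately show ?thesis by linarith
  qed
  moreover have "measure_pmf.expectation (prior p1) \<Phi> \<le> 1/3 + 1/1000"
  proof -
    have p1_0: "set_pmf p1 \<subseteq> {0..16 * (real m)\<^sup>2}" using supp by auto
    have "measure_pmf.expectation (prior p1) \<Phi> \<le> measure_pmf.expectation (prior p1) (\<lambda>f. 1/3 + indicator bad f)"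
    proof (rule integral_mono_AE[OF int(2) int(2)], unfold AE_measure_pmf_iff, intro ballI)
      fix f assume f: "f \<in> set_pmf (prior p1)"
      have "0 \<le> f i" if "i < N" for i using supp_prior[OF f that] p1_0 by auto
      then have "\<Phi> f \<le> 1" by (rule \<Phi>_bounds)
      then show "\<Phi> f \<le> 1/3 + indicator bad f"
        using upper[OF f] by (auto simp: bad_def indicator_def not_le)
    qed
    also have "\<dots> = 1/3 + measure (prior p1) bad" by (simp add: int)
    also have "measure (prior p1) bad \<le> 1/1000"
      using conc[OF fin(2) p1_0] \<mu>1 small_tail by (simp add: bad_def)
    finally show ?thesis by simp
  qed
  moreover have "\<bar>measure_pmf.expectation (prior p0) \<Phi> - measure_pmf.expectation (prior p1) \<Phi>\<bar> \<le> 1/64"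
  proof -
    define n where "n = 2 * m + 1"
    define Y where "Y = real m / 64"
    define \<delta> where "\<delta> = 2 * ((2 * Y) ^ n / fact n * exp (2 * Y))"
    have "\<bar>measure_pmf.expectation (prior p0) \<Phi> - measure_pmf.expectation (prior p1) \<Phi>\<bar> \<le> real (card {..<N}) * \<delta>"
      unfolding prior_def
    proof (rule Lindeberg_swap[OF _ fin])
      fix t and y :: "nat \<Rightarrow> real"
      assume t: "t \<in> {..<N}" and y: "\<And>i. i \<in> {..<N} - {t} \<Longrightarrow> y i \<in> set_pmf p0 \<union> set_pmf p1"
      have y0: "0 \<le> lam * y i" if "i < N" "i \<noteq> t" for i
        using y[of i] that supp lam by fastforce
      have "\<bar>g x\<bar> \<le> 1" for x using g[of x] by simp
      with t y0 obtain Q where Q: "\<And>u. poissonized N q K g ((\<lambda>i. lam * y i)(t := u)) = exp (- u) * poly Q u"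
        "\<And>c. \<bar>coeff Q c\<bar> \<le> 1 / fact c"
        by (metis lessThan_iff poissonized_coordinate)
      have *: "\<Phi> (y(t := u)) = exp (- (lam * u)) * poly Q (lam * u)" for u
      proof -
        have "(\<lambda>i. lam * (y(t := u)) i) = (\<lambda>i. lam * y i)(t := lam * u)" by auto
        then show ?thesis unfolding \<Phi>_def by (simp only: Q(1))
      qed
      have E: "measure_pmf.expectation p (\<lambda>u. \<Phi> (y(t := u))) =
          measure_pmf.expectation (map_pmf ((*) lam) p) (\<lambda>u. exp (- u) * poly Q u)" for p
        by (simp add: * integral_map_pmf)
      show "\<bar>measure_pmf.expectation p0 (\<lambda>u. \<Phi> (y(t := u))) - measure_pmf.expectation p1 (\<lambda>u. \<Phi> (y(t := u)))\<bar> \<le> \<delta>"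
        unfolding E \<delta>_def
      proof (rule moment_matching_poly_times_exp[OF _ _ _ _ _ Q(2)])
        have lamY: "lam * u \<in> {0..Y}" if "u \<in> {0..16 * (real m)\<^sup>2}" for u
        proof -
          have "lam * u \<le> lam * (16 * (real m)\<^sup>2)" using lam that by (intro mult_left_mono) auto
          also have "\<dots> = Y" using m0 by (simp add: lam_def Y_def power2_eq_square)
          finally show ?thesis using lam that by simp
        qed
        have "set_pmf p1 \<subseteq> {0..16 * (real m)\<^sup>2}" using supp(2) by auto
        with supp(1) lamY show "set_pmf (map_pmf ((*) lam) p0) \<subseteq> {0..Y}" "set_pmf (map_pmf ((*) lam) p1) \<subseteq> {0..Y}"
          unfolding set_map_pmf by blast+
        show "measure_pmf.expectation (map_pmf ((*) lam) p0) (\<lambda>x. x ^ d) =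
            measure_pmf.expectation (map_pmf ((*) lam) p1) (\<lambda>x. x ^ d)" if "d < n" for d
          using moments[of d] that by (simp add: integral_map_pmf power_mult_distrib n_def)
      qed (use fin in auto)
    qed simp
    \<comment> \<open>By \<open>1 / fact n \<le> (3 / n) ^ n\<close> and \<open>n > 2 * m\<close>,
      the remainder is at most \<open>(1/16) ^ n\<close>, so \<open>\<delta>\<close> is at most
      \<open>2 ^ m / (8 * 256 ^ m)\<close>. Multiplying by \<open>N \<le> 2 ^ m\<close> still leaves
      \<open>(1/8) * (1/64) ^ m\<close>.\<close>
    also have "real (card {..<N}) * \<delta> \<le> 1/64"
    proof -
      have n0: "real n > 0" by (simp add: n_def)
      have "real n ^ n / fact n \<le> exp (real n)" using sum_le_exp[of "real n" "{n}"] by simp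
      also have "\<dots> = exp 1 ^ n" by (simp flip: exp_of_nat_mult)
      also have "\<dots> \<le> 3 ^ n" using exp_le by (intro power_mono) auto
      finally have "1 / fact n \<le> (3 / real n) ^ n" using n0 by (simp add: field_simps)
      then have "(2 * Y) ^ n * (1 / fact n) \<le> (2 * Y) ^ n * (3 / real n) ^ n"
        by (intro mult_left_mono) (auto simp: Y_def)
      also have "\<dots> = (3 * real m / (32 * real n)) ^ n"
        unfolding power_mult_distrib[symmetric] by (simp add: Y_def field_simps)
      also have "\<dots> \<le> (1/16) ^ n" using n0 by (intro power_mono) (auto simp: n_def field_simps)
      also have "\<dots> = 1 / (16 * 256 ^ m)" by (simp add: n_def power_add power_mult power_one_over)
      finally have 1: "(2 * Y) ^ n / fact n \<le> 1 / (16 * 256 ^ m)" by simp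
      have "2 * Y \<le> real m * (2/3)" by (simp add: Y_def)
      also have "\<dots> \<le> real m * ln 2" using ln2_ge_two_thirds by (intro mult_left_mono) auto
      finally have "exp (2 * Y) \<le> exp (real m * ln 2)" by simp
      then have 2: "exp (2 * Y) \<le> 2 ^ m" by (simp add: exp_of_nat_mult)
      have "\<delta> \<le> 2 * (1 / (16 * 256 ^ m) * 2 ^ m)"
        unfolding \<delta>_def by (intro mult_left_mono mult_mono 1 2) (auto simp: Y_def)
      moreover have "real N \<le> 2 ^ m" using N(2) by (metis of_nat_le_iff of_nat_numeral of_nat_power)
      ultimately have "real N * \<delta> \<le> 2 ^ m * (2 * (1 / (16 * 256 ^ m) * 2 ^ m))"
        by (intro mult_mono) (auto simp: \<delta>_def Y_def)
      also have "\<dots> = (1/8) * (1/64) ^ m"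
        by (simp add: power_divide flip: power_mult_distrib) (simp add: field_simps flip: power_mult_distrib)
      also have "\<dots> \<le> (1/8) * (1/64) ^ 1" using m by (intro mult_left_mono power_decreasing) auto
      finally show ?thesis by simp
    qed
    finally show ?thesis .
  qed
  ultimately show False by linarith
qed

section \<open>Decision trees on a segment\<close>

lemma card_threshold_crossings_le_1:
  fixes a :: "nat \<Rightarrow> real"
  assumes "mono a"
  shows "card {i. i < N \<and> (a i < t) \<noteq> (a (Suc i) < t)} \<le> 1"
proof -
  have "i = j" if "(a i < t) \<noteq> (a (Suc i) < t)" "(a j < t) \<noteq> (a (Suc j) < t)" for i j
  proof -
    have "\<not> i < j" if "(a i < t) \<noteq> (a (Suc i) < t)" "(a j < t) \<noteq> (a (Suc j) < t)" for i j
    proof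
      assume "i < j"
      then have "a i \<le> a (Suc i)" "a (Suc i) \<le> a j" "a j \<le> a (Suc j)"
        using assms by (auto intro: monoD)
      with that show False by auto
    qed
    with that show ?thesis by (meson linorder_neqE_nat)
  qed
  then show ?thesis by (auto simp: card_le_Suc0_iff_eq)
qed

text \<open>If the label changes between neighbours, then either the root test changes its outcome
  or both points enter the same subtree and its label changes. Along a coordinatewise monotone
  sequence each test changes at most once.\<close>

lemma card_label_changes_le:
  fixes x :: "nat \<Rightarrow> point"
  assumes "\<And>j. mono (\<lambda>i. x i j)"
  shows "card {i. i < N \<and> dt_eval T (x i) \<noteq> dt_eval T (x (Suc i))} \<le> dt_nodes T"
proof (induction T)
  case (Test j t l r)
  define C where "C f = {i. i < N \<and> f (x i) \<noteq> f (x (Suc i))}" for f :: "point \<Rightarrow> bool"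
  have fin: "finite (C f)" for f by (simp add: C_def)
  have "C (dt_eval (Test j t l r)) \<subseteq> C (\<lambda>x. x j < t) \<union> (C (dt_eval l) \<union> C (dt_eval r))"
    by (auto simp: C_def split: if_splits)
  then have "card (C (dt_eval (Test j t l r))) \<le> card (C (\<lambda>x. x j < t) \<union> (C (dt_eval l) \<union> C (dt_eval r)))"
    using fin by (intro card_mono) auto
  also have "\<dots> \<le> card (C (\<lambda>x. x j < t)) + (card (C (dt_eval l)) + card (C (dt_eval r)))"
    by (meson card_Un_le add_left_mono order_trans)
  also have "\<dots> \<le> 1 + (dt_nodes l + dt_nodes r)"
    using Test card_threshold_crossings_le_1[OF assms[of j], of N t]
    unfolding C_def by (intro add_mono) auto
  finally show ?case by (simp add: C_def)
qed simp

text \<open>One threshold at the largest point separates it from all smaller ones. For empty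
  \<open>I\<close> the truncated bound is 0, which a single leaf meets.\<close>

lemma exists_tree_interpolating:
  fixes x :: "nat \<Rightarrow> point" and b :: "nat \<Rightarrow> bool"
  assumes "finite I" and mono: "\<And>i j. i < j \<Longrightarrow> x i 1 < x j 1"
  shows "\<exists>T. dt_nodes T \<le> card I - 1 \<and> dt_vars T \<subseteq> {1} \<and> (\<forall>i\<in>I. dt_eval T (x i) = b i)"
  using assms(1)
proof (induction I rule: finite_linorder_max_induct)
  case empty
  show ?case by (intro exI[of _ "Label True"]) simp
next
  case (insert m I)
  show ?case
  proof (cases "I = {}")
    case True
    then show ?thesis by (intro exI[of _ "Label (b m)"]) simp
  next
    case False
    then have "card I > 0" using insert.hyps by (simp add: card_gt_0_iff)
    moreover have "card (insert m I) = Suc (card I)" using insert.hyps by auto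
    moreover obtain T where "dt_nodes T \<le> card I - 1" "dt_vars T \<subseteq> {1}" "\<forall>i\<in>I. dt_eval T (x i) = b i"
      using insert.IH by blast
    ultimately show ?thesis
      using insert.hyps mono by (intro exI[of _ "Test 1 (x m 1) T (Label (b m))"]) auto
  qed
qed

text \<open>An infinite increasing sequence inside the cube, so that the same points serve for every
  \<open>N\<close>.\<close>

definition line_point :: "nat \<Rightarrow> nat \<Rightarrow> point" where
  "line_point n i = (\<lambda>j\<in>{1..n}. if j = 1 then real i / real (Suc i) else 0)"

text \<open>A single total labelling, independent of \<open>N\<close> and of the distribution, so
  that a tester's queries have answers fixed in advance. Off the segment \<open>inv\<close> supplies
  some fixed value.\<close>

definition alternating :: "nat \<Rightarrow> point \<Rightarrow> bool" where
  "alternating n x = even (inv (line_point n) x)"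

lemma ratio_strict_mono: "i < j \<Longrightarrow> real i / real (Suc i) < real j / real (Suc j)"
  by (simp add: divide_simps) (simp add: algebra_simps)

lemma line_point_strict_mono: "n \<ge> 1 \<Longrightarrow> i < j \<Longrightarrow> line_point n i 1 < line_point n j 1"
  using ratio_strict_mono[of i j] by (simp add: line_point_def)

lemma line_point_mono: "mono (\<lambda>i. line_point n i j)"
  using ratio_strict_mono by (auto simp: line_point_def mono_def le_less restrict_def)

lemma inj_line_point: "n \<ge> 1 \<Longrightarrow> inj (line_point n)"
  by (metis injI less_irrefl line_point_strict_mono linorder_neqE_nat)

lemma line_point_in_cube: "line_point n i \<in> cube n"
  by (auto simp: line_point_def cube_def)

lemma alternating_line_point: "n \<ge> 1 \<Longrightarrow> alternating n (line_point n i) = even i"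
  by (simp add: alternating_def inj_line_point)

text \<open>Since the target alternates, each of the \<open>N - 1\<close> neighbouring pairs either
  sees \<open>h\<close> change, which happens at most \<open>k\<close> times, or contains an error;
  and an error lies in at most two pairs.\<close>

lemma many_errors_against_alternating:
  assumes n: "n \<ge> 1" and h: "h \<in> tree_class n k"
  shows "N \<le> Suc k + 2 * card {i. i < N \<and> alternating n (line_point n i) \<noteq> h (line_point n i)}"
proof (cases N)
  case (Suc N')
  define b where "b i = h (line_point n i)" for i
  define err where "err = {i. i < N \<and> even i \<noteq> b i}"
  obtain T where T: "dt_nodes T \<le> k" "\<And>i. b i = dt_eval T (line_point n i)"
    using h line_point_in_cube unfolding tree_class_def b_def by blast
  have "card {i. i < N' \<and> b i \<noteq> b (Suc i)} \<le> k"
    using card_label_changes_le[of "line_point n" N' T] line_point_mono T by auto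
  moreover have "{..<N'} \<subseteq> {i. i < N' \<and> b i \<noteq> b (Suc i)} \<union> (err \<union> (\<lambda>i. i - 1) ` err)"
  proof
    fix i assume "i \<in> {..<N'}"
    moreover have "Suc i \<in> err \<Longrightarrow> i \<in> (\<lambda>i. i - 1) ` err" by force
    ultimately show "i \<in> {i. i < N' \<and> b i \<noteq> b (Suc i)} \<union> (err \<union> (\<lambda>i. i - 1) ` err)"
      by (auto simp: err_def Suc)
  qed
  moreover have fin: "finite err" by (simp add: err_def)
  ultimately have "card {..<N'} \<le> card ({i. i < N' \<and> b i \<noteq> b (Suc i)} \<union> (err \<union> (\<lambda>i. i - 1) ` err))"
    by (intro card_mono) auto
  also have "\<dots> \<le> card {i. i < N' \<and> b i \<noteq> b (Suc i)} + (card err + card ((\<lambda>i. i - 1) ` err))"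
    by (meson card_Un_le add_left_mono order_trans)
  also have "\<dots> \<le> k + (card err + card err)"
    using \<open>card _ \<le> k\<close> card_image_le[OF fin] by (intro add_mono) auto
  finally show ?thesis using n by (simp add: Suc err_def b_def alternating_line_point)
qed simp

section \<open>Distance to trees under discrete distributions on the segment\<close>

abbreviation on_cube :: "nat \<Rightarrow> point pmf \<Rightarrow> point measure" where
  "on_cube n p \<equiv> restrict_space (measure_pmf p) (cube n)"

lemma class_dist_on_cube_ge:
  assumes n: "n \<ge> 1" and p: "\<And>i. i < N \<Longrightarrow> \<beta> \<le> pmf p (line_point n i)" and "0 \<le> \<beta>"
  shows "\<beta> * (real N - real k - 1) / 2 \<le> class_dist (on_cube n p) (alternating n) (tree_class n k)"
  unfolding class_dist_def
proof (rule cINF_greatest)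
  have "dt_eval (Label True) \<in> tree_class n k" unfolding tree_class_def by (force intro: exI[of _ "Label True"])
  then show "tree_class n k \<noteq> {}" by blast
next
  fix h assume h: "h \<in> tree_class n k"
  define err where "err = {i. i < N \<and> alternating n (line_point n i) \<noteq> h (line_point n i)}"
  have "N \<le> Suc k + 2 * card err" unfolding err_def by (rule many_errors_against_alternating[OF n h])
  then have "real N \<le> real (Suc k + 2 * card err)" by (rule of_nat_mono)
  then have "(real N - real k - 1) / 2 \<le> real (card err)" by simp
  then have "\<beta> * ((real N - real k - 1) / 2) \<le> \<beta> * real (card err)" using assms(3) by (rule mult_left_mono)
  also have "\<dots> = (\<Sum>i\<in>err. \<beta>)" by simp
  also have "\<dots> \<le> (\<Sum>i\<in>err. pmf p (line_point n i))" using p by (intro sum_mono) (auto simp: err_def)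
  also have "\<dots> = (\<Sum>x\<in>line_point n ` err. pmf p x)"
    using inj_line_point[OF n] by (subst sum.reindex) (auto intro: inj_on_subset)
  also have "\<dots> = measure p (line_point n ` err)"
    by (subst measure_measure_pmf_finite) (auto simp: err_def)
  also have "\<dots> \<le> measure p {x \<in> cube n. alternating n x \<noteq> h x}"
    using line_point_in_cube by (intro measure_pmf.finite_measure_mono) (auto simp: err_def)
  also have "\<dots> = fun_dist (on_cube n p) (alternating n) h"
    unfolding fun_dist_def by (subst measure_restrict_space) (auto simp: space_restrict_space)
  finally show "\<beta> * (real N - real k - 1) / 2 \<le> fun_dist (on_cube n p) (alternating n) h" by simp
qed

lemma exists_tree_on_small_support:
  assumes n: "n \<ge> 1" and p: "set_pmf p \<subseteq> range (line_point n)" "finite (set_pmf p)" "card (set_pmf p) \<le> Suc k"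
  obtains h where "h \<in> tree_class n k" "\<And>x. x \<in> set_pmf p \<Longrightarrow> h x = alternating n x"
proof -
  define I where "I = line_point n -` set_pmf p"
  have "card I = card (set_pmf p)" "finite I"
    unfolding I_def using p inj_line_point[OF n]
    by (auto simp: card_vimage_inj intro: finite_vimageI)
  then obtain T where T: "dt_nodes T \<le> card (set_pmf p) - 1" "dt_vars T \<subseteq> {1}"
      "\<forall>i\<in>I. dt_eval T (line_point n i) = even i"
    using exists_tree_interpolating[of I "line_point n" even] line_point_strict_mono[OF n] by auto
  show ?thesis
  proof (rule that[of "dt_eval T"])
    show "dt_eval T \<in> tree_class n k"
      unfolding tree_class_def using T(1,2) p(3) n by (auto intro!: exI[of _ T])
    fix x assume "x \<in> set_pmf p"
    moreover from this obtain i where "x = line_point n i" using p by auto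
    ultimately show "dt_eval T x = alternating n x"
      using T(3) n by (auto simp: I_def alternating_line_point)
  qed
qed

lemma class_dist_on_cube_eq_0:
  assumes "h \<in> tree_class n k" "\<And>x. x \<in> set_pmf p \<Longrightarrow> h x = f x"
  shows "class_dist (on_cube n p) f (tree_class n k) = 0"
proof (rule antisym)
  have "fun_dist (on_cube n p) f h = measure p {x \<in> cube n. f x \<noteq> h x}"
    unfolding fun_dist_def by (subst measure_restrict_space) (auto simp: space_restrict_space)
  also have "\<dots> = 0" using assms(2) by (auto simp: measure_pmf_zero_iff)
  finally have "fun_dist (on_cube n p) f h = 0" .
  moreover have "class_dist (on_cube n p) f (tree_class n k) \<le> fun_dist (on_cube n p) f h"
    unfolding class_dist_def using assms(1)
    by (intro cINF_lower bdd_belowI[of _ 0]) (auto simp: fun_dist_def)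
  ultimately show "class_dist (on_cube n p) f (tree_class n k) \<le> 0" by simp
  show "0 \<le> class_dist (on_cube n p) f (tree_class n k)"
    unfolding class_dist_def using assms(1) by (intro cINF_greatest) (auto simp: fun_dist_def)
qed

section \<open>From testers to discriminators of weights\<close>

definition inner_prob :: "'a measure \<Rightarrow> ('a \<Rightarrow> bool) \<Rightarrow> real" where
  "inner_prob M P = (SUP E\<in>{E \<in> sets M. \<forall>x\<in>E. P x}. measure M E)"

context prob_space
begin

lemma inner_prob_bdd: "bdd_above (measure M ` {E \<in> sets M. \<forall>x\<in>E. P x})"
  by (intro bdd_aboveI[of _ 1]) auto

lemma le_inner_prob: "E \<in> sets M \<Longrightarrow> (\<And>x. x \<in> E \<Longrightarrow> P x) \<Longrightarrow> prob E \<le> inner_prob M P"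
  unfolding inner_prob_def by (intro cSUP_upper inner_prob_bdd) auto

lemma inner_prob_nonneg: "0 \<le> inner_prob M P"
  using le_inner_prob[of "{}" P] by simp

lemma inner_prob_le:
  assumes "\<And>E. E \<in> sets M \<Longrightarrow> \<forall>x\<in>E. P x \<Longrightarrow> prob E \<le> c"
  shows "inner_prob M P \<le> c"
  unfolding inner_prob_def by (rule cSUP_least) (use assms in auto)

lemma inner_prob_le_1: "inner_prob M P \<le> 1"
  by (rule inner_prob_le) simp

text \<open>Measurable parts of an event and of its complement are disjoint. Equality may fail
  without measurability; this direction turns a rejection guarantee into an upper bound on
  acceptance.\<close>

lemma inner_prob_not: "inner_prob M (\<lambda>x. \<not> P x) \<le> 1 - inner_prob M P"
proof (rule inner_prob_le)
  fix E assume E: "E \<in> sets M" "\<forall>x\<in>E. \<not> P x"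
  have "inner_prob M P \<le> 1 - prob E"
  proof (rule inner_prob_le)
    fix E' assume E': "E' \<in> sets M" "\<forall>x\<in>E'. P x"
    then have "prob (E \<union> E') = prob E + prob E'" using E by (intro finite_measure_Union) auto
    with prob_le_1[of "E \<union> E'"] show "prob E' \<le> 1 - prob E" by simp
  qed
  then show "prob E \<le> 1 - inner_prob M P" by simp
qed

end

text \<open>The sample sequence almost surely lies in a finite set of atoms. Fubini therefore writes
  the measure of a measurable part of the event as a finite sum over its sections, and each section
  is a measurable set of seeds, bounded by the inner probability.\<close>

lemma prob_at_least_product_pmf:
  fixes p :: "'a pmf" and R :: "'s measure" and q :: nat
  assumes R: "prob_space R" and p: "finite (set_pmf p)" "set_pmf p \<subseteq> X"
    and P: "prob_at_least (R \<Otimes>\<^sub>M PiM {..<q} (\<lambda>_. restrict_space (measure_pmf p) X)) P c"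
  shows "c \<le> (\<Sum>x\<in>PiE {..<q} (\<lambda>_. set_pmf p). (\<Prod>i<q. pmf p (x i)) * inner_prob R (\<lambda>s. P (s, x)))"
proof -
  define D where "D = restrict_space (measure_pmf p) X"
  define PS where "PS = PiM {..<q} (\<lambda>_. D)"
  define S where "S = PiE {..<q} (\<lambda>_. set_pmf p)"
  interpret R: prob_space R by fact
  have "emeasure (measure_pmf p) X = 1"
    using p by (subst measure_pmf.emeasure_eq_1_AE) (auto simp: AE_measure_pmf_iff)
  then interpret D: prob_space D
    unfolding D_def by (intro prob_spaceI) (simp add: space_restrict_space emeasure_restrict_space)
  interpret PD: product_prob_space "\<lambda>_::nat. D" by unfold_locales
  interpret PS: prob_space PS unfolding PS_def by (intro prob_space_PiM D.prob_space_axioms)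
  interpret RP: pair_sigma_finite R PS by unfold_locales
  have setsD: "A \<in> sets D" if "A \<subseteq> X" for A using that by (auto simp: D_def sets_restrict_space)
  have emD: "emeasure D A = emeasure (measure_pmf p) A" if "A \<subseteq> X" for A
    using that unfolding D_def by (subst emeasure_restrict_space) auto
  have finS: "finite S" unfolding S_def using p by (intro finite_PiE) auto
  have single: "{x} = PiE {..<q} (\<lambda>i. {x i})" "\<And>i. i < q \<Longrightarrow> {x i} \<subseteq> X" if "x \<in> S" for x
    using that p PiE_singleton[of x "{..<q}"] by (auto simp: S_def PiE_iff)
  have setsx: "{x} \<in> sets PS" if "x \<in> S" for x
    unfolding single(1)[OF that] PS_def using single(2)[OF that] by (intro sets_PiM_I_finite setsD) auto
  have emx: "emeasure PS {x} = ennreal (\<Prod>i<q. pmf p (x i))" if "x \<in> S" for x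
  proof -
    have "emeasure PS {x} = (\<Prod>i<q. emeasure D {x i})"
      unfolding single(1)[OF that] PS_def using single(2)[OF that] by (intro PD.emeasure_PiM setsD) auto
    also have "\<dots> = (\<Prod>i<q. ennreal (pmf p (x i)))"
      using single(2)[OF that] by (intro prod.cong) (auto simp: emD emeasure_pmf_single)
    finally show ?thesis by (simp add: prod_ennreal)
  qed
  have setsS: "S \<in> sets PS" unfolding S_def PS_def using p by (intro sets_PiM_I_finite setsD) auto
  have "emeasure PS S = (\<Prod>i<q. emeasure D (set_pmf p))"
    unfolding S_def PS_def using p by (intro PD.emeasure_PiM setsD) auto
  also have "emeasure D (set_pmf p) = 1"
    using p by (simp add: emD measure_pmf.emeasure_eq_1_AE AE_measure_pmf_iff)
  finally have "emeasure PS S = 1" by simp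
  then have AE: "AE x in PS. x \<in> S" using setsS by (intro PS.AE_prob_1) (simp add: measure_def)
  obtain E where E: "E \<in> sets (R \<Otimes>\<^sub>M PS)" "\<forall>\<omega>\<in>E. P \<omega>" "c \<le> measure (R \<Otimes>\<^sub>M PS) E"
    using P unfolding prob_at_least_def PS_def D_def by blast
  define G where "G x = inner_prob R (\<lambda>s. P (s, x))" for x
  have G0: "0 \<le> G x" for x unfolding G_def by (rule R.inner_prob_nonneg)
  have le: "emeasure R ((\<lambda>s. (s, x)) -` E) \<le> ennreal (G x)" for x
    unfolding R.emeasure_eq_measure G_def using E
    by (intro ennreal_leI R.le_inner_prob) (auto intro: sets_Pair2)
  have "emeasure (R \<Otimes>\<^sub>M PS) E = (\<integral>\<^sup>+x. emeasure R ((\<lambda>s. (s, x)) -` E) \<partial>PS)"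
    using E by (intro RP.emeasure_pair_measure_alt2)
  also have "\<dots> \<le> (\<integral>\<^sup>+x. ennreal (G x) * indicator S x \<partial>PS)"
    using AE by (intro nn_integral_mono_AE) (auto simp: le indicator_def elim!: eventually_mono)
  also have "\<dots> = (\<Sum>x\<in>S. ennreal (G x) * emeasure PS {x})"
    using finS setsx by (rule nn_integral_indicator_finite)
  also have "\<dots> = (\<Sum>x\<in>S. ennreal ((\<Prod>i<q. pmf p (x i)) * G x))"
    using G0 by (intro sum.cong) (simp_all add: emx ennreal_mult prod_nonneg mult.commute)
  also have "\<dots> = ennreal (\<Sum>x\<in>S. (\<Prod>i<q. pmf p (x i)) * G x)"
    using G0 by (intro sum_ennreal) (simp add: prod_nonneg)
  finally have "measure (R \<Otimes>\<^sub>M PS) E \<le> (\<Sum>x\<in>S. (\<Prod>i<q. pmf p (x i)) * G x)"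
    unfolding measure_def using G0 by (intro enn2real_leI sum_nonneg mult_nonneg_nonneg prod_nonneg) auto
  with E(3) show ?thesis by (simp add: S_def G_def)
qed

lemma sample_mean_cong:
  "(\<And>i. i < N \<Longrightarrow> y i = y' i) \<Longrightarrow> sample_mean N q g y = sample_mean N q g y'"
  unfolding sample_mean_def by (intro sum.cong refl arg_cong2[of _ _ _ _ "(*)"] prod.cong) (auto simp: PiE_iff)

lemma sample_mean_le_complement:
  assumes "\<And>i. i < N \<Longrightarrow> 0 \<le> y i" "(\<Sum>i<N. y i) = 1" "\<And>x. g' x \<le> 1 - g x"
  shows "sample_mean N q g' y \<le> 1 - sample_mean N q g y"
proof -
  have "sample_mean N q g' y \<le> (\<Sum>x\<in>PiE {..<q} (\<lambda>_. {..<N}). (\<Prod>i<q. y (x i)) * (1 - g x))"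
    unfolding sample_mean_def using assms by (intro sum_mono mult_left_mono prod_nonneg) (auto simp: PiE_iff)
  also have "\<dots> = (\<Sum>x\<in>PiE {..<q} (\<lambda>_. {..<N}). (\<Prod>i<q. y (x i))) - sample_mean N q g y"
    by (simp add: sample_mean_def right_diff_distrib sum_subtractf)
  also have "(\<Sum>x\<in>PiE {..<q} (\<lambda>_. {..<N}). (\<Prod>i<q. y (x i))) = 1"
    using prod_sum_PiE[of "{..<q}" "\<lambda>_. {..<N}" "\<lambda>_. y"] assms(2) by simp
  finally show ?thesis .
qed

text \<open>Passes from points to indices along the injection \<open>line_point n\<close>. Agreement
  of \<open>P\<close> and \<open>Q\<close> on samples from the support suffices, so a target may be
  replaced by one with the same labels there.\<close>

lemma sample_mean_ge_of_prob_at_least: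
  fixes p :: "nat pmf" and R :: "'s measure" and q :: nat
  assumes n: "n \<ge> 1" and R: "prob_space R" and p: "set_pmf p \<subseteq> {..<N}"
    and P: "prob_at_least (R \<Otimes>\<^sub>M PiM {..<q} (\<lambda>_. on_cube n (map_pmf (line_point n) p))) P c"
    and PQ: "\<And>s x. x \<in> PiE {..<q} (\<lambda>_. line_point n ` set_pmf p) \<Longrightarrow> P (s, x) = Q (s, x)"
  shows "c \<le> sample_mean N q (\<lambda>x. inner_prob R (\<lambda>s. Q (s, \<lambda>i\<in>{..<q}. line_point n (x i)))) (pmf p)"
proof -
  interpret R: prob_space R by fact
  define lift where "lift x = (\<lambda>i\<in>{..<q}. line_point n (x i))" for x :: "nat \<Rightarrow> nat"
  define S where "S = PiE {..<q} (\<lambda>_. set_pmf p)"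
  have inj: "inj_on lift S"
  proof (rule inj_onI)
    fix x y assume xy: "x \<in> S" "y \<in> S" "lift x = lift y"
    show "x = y"
    proof (rule PiE_ext[OF xy(1,2)[unfolded S_def]])
      fix i assume "i \<in> {..<q}"
      then have "line_point n (x i) = line_point n (y i)"
        using fun_cong[OF xy(3), of i] by (simp add: lift_def)
      then show "x i = y i" using inj_line_point[OF n] by (simp add: inj_eq)
    qed
  qed
  have img: "PiE {..<q} (\<lambda>_. line_point n ` set_pmf p) = lift ` S"
  proof (intro equalityI subsetI)
    fix y assume y: "y \<in> PiE {..<q} (\<lambda>_. line_point n ` set_pmf p)"
    define x where "x = (\<lambda>i\<in>{..<q}. inv (line_point n) (y i))"
    have *: "\<exists>j\<in>set_pmf p. y i = line_point n j" if "i < q" for i using y that by auto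
    have "x \<in> S" using * inj_line_point[OF n] by (force simp: S_def x_def)
    moreover have "y = lift x"
    proof
      fix i
      show "y i = lift x i"
        using y *[of i] inj_line_point[OF n] by (cases "i < q") (auto simp: lift_def x_def PiE_iff extensional_def)
    qed
    ultimately show "y \<in> lift ` S" by blast
  qed (auto simp: S_def lift_def PiE_iff)
  have "finite (set_pmf p)" using p by (rule finite_subset) simp
  then have "c \<le> (\<Sum>y\<in>PiE {..<q} (\<lambda>_. set_pmf (map_pmf (line_point n) p)).
      (\<Prod>i<q. pmf (map_pmf (line_point n) p) (y i)) * inner_prob R (\<lambda>s. P (s, y)))"
    by (intro prob_at_least_product_pmf[OF R _ _ P]) (auto simp: line_point_in_cube)
  also have "\<dots> = (\<Sum>x\<in>S. (\<Prod>i<q. pmf (map_pmf (line_point n) p) (lift x i)) * inner_prob R (\<lambda>s. P (s, lift x)))"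
    unfolding set_map_pmf img by (subst sum.reindex[OF inj]) simp
  also have "\<dots> = (\<Sum>x\<in>S. (\<Prod>i<q. pmf p (x i)) * inner_prob R (\<lambda>s. Q (s, lift x)))"
  proof (intro sum.cong refl arg_cong2[of _ _ _ _ "(*)"] prod.cong)
    fix x i assume "i \<in> {..<q}"
    then show "pmf (map_pmf (line_point n) p) (lift x i) = pmf p (x i)"
      using inj_line_point[OF n] by (simp add: lift_def pmf_map_inj')
  next
    fix x assume "x \<in> S"
    then have "lift x \<in> PiE {..<q} (\<lambda>_. line_point n ` set_pmf p)" unfolding img by blast
    then show "inner_prob R (\<lambda>s. P (s, lift x)) = inner_prob R (\<lambda>s. Q (s, lift x))" by (simp add: PQ)
  qed
  also have "\<dots> \<le> (\<Sum>x\<in>PiE {..<q} (\<lambda>_. {..<N}). (\<Prod>i<q. pmf p (x i)) * inner_prob R (\<lambda>s. Q (s, lift x)))"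
    using p unfolding S_def
    by (intro sum_mono2 finite_PiE PiE_mono mult_nonneg_nonneg prod_nonneg R.inner_prob_nonneg) auto
  finally show ?thesis by (simp add: sample_mean_def lift_def)
qed

text \<open>What is left of a tester once the labels are known: \<open>g\<close> is its acceptance
  probability given the sampled indices. One \<open>g\<close> must serve all \<open>N\<close> and
  \<open>w\<close>, as the tester does not know the distribution. The bound in the last clause is
  the distance guaranteed by \<open>class_dist_on_cube_ge\<close>.\<close>

definition discriminates :: "nat \<Rightarrow> real \<Rightarrow> nat \<Rightarrow> ((nat \<Rightarrow> nat) \<Rightarrow> real) \<Rightarrow> bool" where
  "discriminates k \<epsilon> q g \<longleftrightarrow> (\<forall>x. 0 \<le> g x \<and> g x \<le> 1) \<and>
     (\<forall>N w. (\<forall>i<N. 0 \<le> w i) \<and> (\<Sum>i<N. w i) = 1 \<and> card {i. i < N \<and> w i \<noteq> 0} \<le> Suc k \<longrightarrow>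
        2/3 \<le> sample_mean N q g w) \<and>
     (\<forall>N w \<beta>. 0 \<le> \<beta> \<and> (\<forall>i<N. \<beta> \<le> w i) \<and> (\<Sum>i<N. w i) = 1 \<and> \<epsilon> \<le> \<beta> * (real N - real k - 1) / 2 \<longrightarrow>
        sample_mean N q g w \<le> 1/3)"

text \<open>The verdict \<open>acc'\<close> in place of \<open>acc\<close> accounts for sample testers, which only accept functions of
  the class itself: there the target is a tree agreeing with \<open>alternating n\<close> on the support.\<close>

lemma discriminator_of_tester:
  fixes acc :: "real \<times> (nat \<Rightarrow> point) \<Rightarrow> bool" and R :: "real measure" and q :: nat
  assumes n: "n \<ge> 1" and R: "prob_space R"
    and yes: "\<And>p. \<lbrakk>finite (set_pmf p); set_pmf p \<subseteq> range (line_point n); card (set_pmf p) \<le> Suc k\<rbrakk> \<Longrightarrow>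
      \<exists>acc'. (\<forall>s. \<forall>x\<in>PiE {..<q} (\<lambda>_. set_pmf p). acc' (s, x) = acc (s, x)) \<and>
        prob_at_least (R \<Otimes>\<^sub>M PiM {..<q} (\<lambda>_. on_cube n p)) acc' (2/3)"
    and no: "\<And>p. \<lbrakk>set_pmf p \<subseteq> range (line_point n);
        \<epsilon> \<le> class_dist (on_cube n p) (alternating n) (tree_class n k)\<rbrakk> \<Longrightarrow>
      prob_at_least (R \<Otimes>\<^sub>M PiM {..<q} (\<lambda>_. on_cube n p)) (\<lambda>\<omega>. \<not> acc \<omega>) (2/3)"
  shows "\<exists>g. discriminates k \<epsilon> q g"
proof -
  interpret R: prob_space R by fact
  define g where "g x = inner_prob R (\<lambda>s. acc (s, \<lambda>i\<in>{..<q}. line_point n (x i)))" for x :: "nat \<Rightarrow> nat"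
  have "discriminates k \<epsilon> q g"
    unfolding discriminates_def
  proof (intro conjI allI impI; (elim conjE)?)
    show "0 \<le> g x" "g x \<le> 1" for x
      unfolding g_def by (rule R.inner_prob_nonneg R.inner_prob_le_1)+
  next
    fix N :: nat and w :: "nat \<Rightarrow> real"
    assume w: "\<forall>i<N. 0 \<le> w i" "(\<Sum>i<N. w i) = 1" and small: "card {i. i < N \<and> w i \<noteq> 0} \<le> Suc k"
    obtain p where p: "set_pmf p \<subseteq> {..<N}" "\<And>i. i < N \<Longrightarrow> pmf p i = w i"
      using pmf_of_weights[of "{..<N}" w] w by auto
    have fin: "finite (set_pmf p)" using p(1) by (rule finite_subset) simp
    have "set_pmf p = {i. i < N \<and> w i \<noteq> 0}" using p by (auto simp: set_pmf_iff)
    then have "card (set_pmf (map_pmf (line_point n) p)) \<le> Suc k"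
      using small card_image_le[OF fin, of "line_point n"] by simp
    with fin obtain acc' where acc': "\<And>s x. x \<in> PiE {..<q} (\<lambda>_. line_point n ` set_pmf p) \<Longrightarrow> acc' (s, x) = acc (s, x)"
      "prob_at_least (R \<Otimes>\<^sub>M PiM {..<q} (\<lambda>_. on_cube n (map_pmf (line_point n) p))) acc' (2/3)"
      using yes[of "map_pmf (line_point n) p"] by (auto simp: image_mono)
    have "2/3 \<le> sample_mean N q g (pmf p)"
      unfolding g_def by (rule sample_mean_ge_of_prob_at_least[OF n R p(1) acc'(2) acc'(1)])
    then show "2/3 \<le> sample_mean N q g w" using sample_mean_cong[of N "pmf p" w] p(2) by simp
  next
    fix N :: nat and w :: "nat \<Rightarrow> real" and \<beta> :: real
    assume \<beta>: "0 \<le> \<beta>" "\<forall>i<N. \<beta> \<le> w i" and w: "(\<Sum>i<N. w i) = 1"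
      and \<epsilon>: "\<epsilon> \<le> \<beta> * (real N - real k - 1) / 2"
    have w0: "0 \<le> w i" if "i < N" for i using \<beta> that by force
    obtain p where p: "set_pmf p \<subseteq> {..<N}" "\<And>i. i < N \<Longrightarrow> pmf p i = w i"
      using pmf_of_weights[of "{..<N}" w] w w0 by auto
    have "\<beta> * (real N - real k - 1) / 2 \<le>
        class_dist (on_cube n (map_pmf (line_point n) p)) (alternating n) (tree_class n k)"
      using \<beta> p inj_line_point[OF n] by (intro class_dist_on_cube_ge n) (auto simp: pmf_map_inj')
    then have "prob_at_least (R \<Otimes>\<^sub>M PiM {..<q} (\<lambda>_. on_cube n (map_pmf (line_point n) p))) (\<lambda>\<omega>. \<not> acc \<omega>) (2/3)"
      using \<epsilon> by (intro no) auto
    from sample_mean_ge_of_prob_at_least[OF n R p(1) this refl]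
    have "2/3 \<le> sample_mean N q (\<lambda>x. inner_prob R (\<lambda>s. \<not> acc (s, \<lambda>i\<in>{..<q}. line_point n (x i)))) w"
      using sample_mean_cong[of N "pmf p" w] p(2) by simp
    also have "\<dots> \<le> 1 - sample_mean N q g w"
      unfolding g_def using w w0 by (intro sample_mean_le_complement R.inner_prob_not) auto
    finally show "sample_mean N q g w \<le> 1/3" by simp
  qed
  then show ?thesis by blast
qed

text \<open>Large \<open>k\<close> reduces to \<open>support_size_lower_bound\<close>. For the
  finitely many smaller \<open>k\<close> it is enough that \<open>q\<close> is at least 1, and the
  term \<open>ln 2 / K'\<close> in \<open>c\<close> pays for that.\<close>

lemma discriminator_lower_bound:
  "\<exists>c>0. \<forall>k q \<epsilon> g. k \<ge> 2 \<and> \<epsilon> \<le> 1/8192 \<and> discriminates k \<epsilon> q g \<longrightarrow>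
    c * (real k / ln (real k)) \<le> real q"
proof -
  have "eventually (\<lambda>k::nat. 2 ^ 18 * (3 * ln (real k))\<^sup>2 \<le> real k) at_top"
    by real_asymp
  then obtain K where K: "\<And>k::nat. k \<ge> K \<Longrightarrow> 2 ^ 18 * (3 * ln (real k))\<^sup>2 \<le> real k"
    unfolding eventually_at_top_linorder by blast
  define K' where "K' = max K 84"
  define c where "c = min (1/32768) (ln 2 / real K')"
  have K'0: "real K' > 0" by (simp add: K'_def)
  show ?thesis
  proof (intro exI[of _ c] conjI allI impI; (elim conjE)?)
    show "c > 0" using K'0 by (simp add: c_def)
  next
    fix k q \<epsilon> g
    assume k: "k \<ge> 2" and \<epsilon>: "\<epsilon> \<le> 1/8192" and disc: "discriminates k \<epsilon> q g"
    have g: "0 \<le> g x" "g x \<le> 1" for x using disc by (auto simp: discriminates_def)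
    have yes: "2/3 \<le> sample_mean N q g w"
      if "\<And>i. i < N \<Longrightarrow> 0 \<le> w i" "(\<Sum>i<N. w i) = 1" "card {i. i < N \<and> w i \<noteq> 0} \<le> Suc k" for N w
      using disc that unfolding discriminates_def by blast
    have no: "sample_mean N q g w \<le> 1/3"
      if "0 \<le> \<beta>" "\<And>i. i < N \<Longrightarrow> \<beta> \<le> w i" "(\<Sum>i<N. w i) = 1" "\<epsilon> \<le> \<beta> * (real N - real k - 1) / 2" for N w \<beta>
      using disc that unfolding discriminates_def by blast
    have c_le: "c \<le> 1/32768" unfolding c_def by (rule min.cobounded1)
    have lnk: "ln (real k) \<ge> ln 2" "ln (2::real) > 0" "ln (real k) > 0" using k by simp_all
    show "c * (real k / ln (real k)) \<le> real q"
    proof (cases "k < K'")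
      case True
      \<comment> \<open>Without samples the mean is one constant, which a point mass forces to be at
        least \<open>2/3\<close> and uniform weights on \<open>2 * (k + 1)\<close> points force to
        be at most \<open>1/3\<close>.\<close>
      have "q \<noteq> 0"
      proof
        assume [simp]: "q = 0"
        have const: "sample_mean N q g w = g (\<lambda>_. undefined)" for N w
          by (simp add: sample_mean_def)
        have "2/3 \<le> sample_mean 1 q g (\<lambda>_. 1)" by (rule yes) auto
        moreover have "sample_mean (2 * (k + 1)) q g (\<lambda>_. 1 / real (2 * (k + 1))) \<le> 1/3"
        proof (rule no[of "1 / real (2 * (k + 1))"])
          have "1 / real (2 * (k + 1)) * (real (2 * (k + 1)) - real k - 1) / 2 = 1/4"
            by (simp add: divide_simps)
          then show "\<epsilon> \<le> 1 / real (2 * (k + 1)) * (real (2 * (k + 1)) - real k - 1) / 2"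
            using \<epsilon> by linarith
        qed auto
        ultimately show False unfolding const by simp
      qed
      then have "1 \<le> real q" by simp
      moreover have "c * (real k / ln (real k)) \<le> (ln 2 / real K') * (real K' / ln 2)"
        using True lnk K'0 by (intro mult_mono frac_le) (auto simp: c_def)
      moreover have "(ln 2 / real K') * (real K' / ln 2) = 1" using lnk K'0 by simp
      ultimately show ?thesis by linarith
    next
      case False
      then have k84: "k \<ge> 84" and Kk: "2 ^ 18 * (3 * ln (real k))\<^sup>2 \<le> real k"
        using K by (auto simp: K'_def)
      \<comment> \<open>Supports of size \<open>7 * r\<close> stay within \<open>k + 1\<close>,
        while \<open>N = 8 * r\<close> exceeds \<open>k + 1\<close> by at least
        \<open>r - 6\<close>, which is at least \<open>r / 2\<close> because
        \<open>k \<ge> 84\<close> gives \<open>r \<ge> 12\<close>.\<close>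
      define r where "r = (k + 1) div 7"
      define N where "N = 8 * r"
      \<comment> \<open>Large enough for \<open>N \<le> 2 * k \<le> 2 ^ m\<close>, yet at most
        \<open>3 * ln k\<close>.\<close>
      define m where "m = nat \<lceil>log 2 (2 * real k)\<rceil>"
      have r: "7 * r \<le> k + 1" "k + 1 \<le> 7 * r + 6" by (auto simp: r_def)
      have r12: "r \<ge> 12" using k84 r by linarith
      have Nk: "k \<le> N" "N \<le> 2 * k" using r k84 by (auto simp: N_def)
      have log0: "log 2 (2 * real k) \<ge> 1" using k by simp
      then have m1: "m \<ge> 1" by (simp add: m_def) linarith
      have logm: "log 2 (2 * real k) \<le> real m" "real m \<le> log 2 (2 * real k) + 1"
        using log0 by (simp_all add: m_def)
      have "real m \<le> 3 * ln (real k)"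
      proof -
        have "4/3 \<le> ln (4::real)"
          using ln2_ge_two_thirds ln_realpow[of 2 2] by simp
        also have "ln 4 \<le> ln (real k)" using k84 by simp
        finally have *: "4/3 \<le> ln (real k)" .
        have "log 2 (2 * real k) = 1 + ln (real k) / ln 2"
          using k by (simp add: log_def ln_mult add_divide_distrib)
        also have "ln (real k) / ln 2 \<le> ln (real k) / (2/3)"
          using * ln2_ge_two_thirds by (intro divide_left_mono) auto
        finally show ?thesis using logm * by simp
      qed
      then have m3: "real m \<le> 3 * ln (real k)" .
      have "2 ^ 18 * (real m)\<^sup>2 \<le> 2 ^ 18 * (3 * ln (real k))\<^sup>2"
        using m3 by (intro mult_left_mono power_mono) auto
      also have "\<dots> \<le> real N" using Kk Nk by linarith
      finally have "real (2 ^ 18 * m\<^sup>2) \<le> real N" by simp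
      then have Nm: "2 ^ 18 * m\<^sup>2 \<le> N" unfolding of_nat_le_iff .
      have "2 * real k \<le> 2 powr real m" using logm(1) k by (simp add: log_le_iff)
      then have "real (2 * k) \<le> real (2 ^ m)" by (simp add: powr_realpow)
      then have "2 * k \<le> 2 ^ m" unfolding of_nat_le_iff .
      then have N2: "N \<le> 2 ^ m" using Nk by linarith
      have "real N < 8192 * real m * real q"
      proof (rule support_size_lower_bound[OF N_def N2 Nm m1 g])
        fix w :: "nat \<Rightarrow> real"
        assume "\<And>i. i < N \<Longrightarrow> 0 \<le> w i" "(\<Sum>i<N. w i) = 1" "card {i. i < N \<and> w i \<noteq> 0} \<le> 7 * r"
        then show "2/3 \<le> sample_mean N q g w" using r by (intro yes) auto
      next
        fix w :: "nat \<Rightarrow> real"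
        assume w: "\<And>i. i < N \<Longrightarrow> 1 / (256 * real N) \<le> w i" "(\<Sum>i<N. w i) = 1"
        have "real (k + 1) \<le> real (7 * r + 6)" using r(2) by (rule of_nat_mono)
        then have "real r / 2 \<le> real N - real k - 1" using r12 by (simp add: N_def)
        then have "1 / (256 * real N) * (real r / 2) \<le> 1 / (256 * real N) * (real N - real k - 1)"
          by (intro mult_left_mono) auto
        \<comment> \<open>Source of the threshold on \<open>\<epsilon>\<close>: for
          \<open>N = 8 * r\<close> this product is \<open>1/4096\<close>, and the distance bound
          halves it.\<close>
        moreover have "1 / (256 * real N) * (real r / 2) = 1/4096" using r12 by (simp add: N_def)
        ultimately have "1/4096 / 2 \<le> 1 / (256 * real N) * (real N - real k - 1) / 2"
          by (intro divide_right_mono) auto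
        then have "\<epsilon> \<le> 1 / (256 * real N) * (real N - real k - 1) / 2"
          by (rule order_trans[rotated]) (use \<epsilon> in simp)
        with w show "sample_mean N q g w \<le> 1/3" by (intro no[of "1 / (256 * real N)"]) auto
      qed
      also have "\<dots> \<le> 8192 * (3 * ln (real k)) * real q"
        using m3 by (intro mult_right_mono mult_left_mono) auto
      finally have "real k \<le> 32768 * ln (real k) * real q" using Nk lnk by (simp add: mult.assoc)
      then have "1/32768 * (real k / ln (real k)) \<le> real q"
        using lnk by (simp add: field_simps)
      moreover have "c * (real k / ln (real k)) \<le> 1/32768 * (real k / ln (real k))"
        using lnk c_le by (intro mult_right_mono) auto
      ultimately show ?thesis by linarith
    qed
  qed
qed

text \<open>Covers the case where no tester exists and the infimum is infinite; otherwise the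
  infimum is attained.\<close>

lemma ereal_le_INF_enat:
  assumes "\<And>m. m \<in> S \<Longrightarrow> x \<le> real m"
  shows "ereal x \<le> ereal_of_enat (INF m\<in>S. enat m)"
proof (cases "S = {}")
  case True
  then show ?thesis by (simp add: top_enat_def)
next
  case False
  then have "(INF m\<in>S. enat m) \<in> enat ` S"
    unfolding Inf_enat_def by (auto intro: LeastI)
  then show ?thesis using assms by auto
qed

theorem theorem3p11:
  "\<exists>\<epsilon>\<^sub>0 c :: real. \<epsilon>\<^sub>0 > 0 \<and> c > 0 \<and>
     (\<forall>(k::nat) (n::nat) (\<epsilon>::real). k \<ge> 2 \<and> n \<ge> 1 \<and> 0 < \<epsilon> \<and> \<epsilon> < \<epsilon>\<^sub>0 \<longrightarrow>
        ereal_of_enat (m_test (cube_borel n) (tree_class n k) \<epsilon>) \<ge> ereal (c * (real k / ln (real k))) \<and>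
        ereal_of_enat (q_test0 (cube_borel n) (tree_class n k) \<epsilon>) \<ge> ereal (c * (real k / ln (real k))))"
proof -
  obtain c :: real where c: "c > 0"
    "\<And>k q \<epsilon> g. \<lbrakk>k \<ge> 2; \<epsilon> \<le> 1/8192; discriminates k \<epsilon> q g\<rbrakk> \<Longrightarrow> c * (real k / ln (real k)) \<le> real q"
    using discriminator_lower_bound by blast
  have "ereal (c * (real k / ln (real k))) \<le> ereal_of_enat (m_test (cube_borel n) (tree_class n k) \<epsilon>)"
    "ereal (c * (real k / ln (real k))) \<le> ereal_of_enat (q_test0 (cube_borel n) (tree_class n k) \<epsilon>)"
    if k: "k \<ge> 2" and n: "n \<ge> 1" and \<epsilon>: "\<epsilon> < 1/8192" for k n \<epsilon>
  proof -
    \<comment> \<open>A restricted pmf carries the full power set of the cube, so every target, in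
      particular \<open>alternating n\<close>, is measurable and the guarantees of a tester apply to
      it.\<close>
    have D: "on_cube n p \<in> distributions (cube_borel n)" "f \<in> on_cube n p \<rightarrow>\<^sub>M count_space UNIV"
      if "set_pmf p \<subseteq> range (line_point n)" for p and f :: "point \<Rightarrow> bool"
      using that line_point_in_cube pmf_in_distributions(1)[of p "cube_borel n"]
        pmf_in_distributions(2)[of p "cube_borel n" f]
      unfolding space_cube_borel by auto
    show "ereal (c * (real k / ln (real k))) \<le> ereal_of_enat (m_test (cube_borel n) (tree_class n k) \<epsilon>)"
      unfolding m_test_def
    proof (rule ereal_le_INF_enat)
      fix q assume "q \<in> {m. \<exists>R A. sample_tester (cube_borel n) (tree_class n k) \<epsilon> m R A}"
      then obtain R A where T: "sample_tester (cube_borel n) (tree_class n k) \<epsilon> q R A" by blast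
      then have R: "prob_space R" by (simp add: sample_tester_def)
      define acc where "acc = accepts_sample q (alternating n) A"
      have "\<exists>g. discriminates k \<epsilon> q g"
      proof (rule discriminator_of_tester[OF n R, where k = k and q = q and acc = acc and \<epsilon> = \<epsilon>])
        fix p assume p: "finite (set_pmf p)" "set_pmf p \<subseteq> range (line_point n)" "card (set_pmf p) \<le> Suc k"
        obtain h where h: "h \<in> tree_class n k" "\<And>x. x \<in> set_pmf p \<Longrightarrow> h x = alternating n x"
          using exists_tree_on_small_support[OF n p(2,1,3)] by blast
        have "accepts_sample q h A (s, x) = acc (s, x)" if "x \<in> PiE {..<q} (\<lambda>_. set_pmf p)" for s x
        proof -
          have labels: "map (\<lambda>i. (x i, h (x i))) [0..<q] = map (\<lambda>i. (x i, alternating n (x i))) [0..<q]"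
            using that h(2) by (auto simp: PiE_iff)
          show ?thesis unfolding acc_def accepts_sample_def prod.case labels ..
        qed
        moreover have "prob_at_least (R \<Otimes>\<^sub>M PiM {..<q} (\<lambda>_. on_cube n p)) (accepts_sample q h A) (2/3)"
          using T D[OF p(2)] h(1) unfolding sample_tester_def by blast
        ultimately show "\<exists>acc'. (\<forall>s. \<forall>x\<in>PiE {..<q} (\<lambda>_. set_pmf p). acc' (s, x) = acc (s, x)) \<and>
            prob_at_least (R \<Otimes>\<^sub>M PiM {..<q} (\<lambda>_. on_cube n p)) acc' (2/3)"
          by blast
      next
        fix p assume p: "set_pmf p \<subseteq> range (line_point n)"
          "\<epsilon> \<le> class_dist (on_cube n p) (alternating n) (tree_class n k)"
        then show "prob_at_least (R \<Otimes>\<^sub>M PiM {..<q} (\<lambda>_. on_cube n p)) (\<lambda>\<omega>. \<not> acc \<omega>) (2/3)"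
          using T D[OF p(1)] unfolding sample_tester_def acc_def by blast
      qed
      then obtain g where "discriminates k \<epsilon> q g" ..
      then show "c * (real k / ln (real k)) \<le> real q" by (rule c(2)[OF k less_imp_le[OF \<epsilon>]])
    qed
    show "ereal (c * (real k / ln (real k))) \<le> ereal_of_enat (q_test0 (cube_borel n) (tree_class n k) \<epsilon>)"
      unfolding q_test0_def
    proof (rule ereal_le_INF_enat)
      fix q assume "q \<in> {m. \<exists>R A. query_tester0 (cube_borel n) (tree_class n k) \<epsilon> m R A}"
      then obtain R A where T: "query_tester0 (cube_borel n) (tree_class n k) \<epsilon> q R A" by blast
      then have R: "prob_space R" by (simp add: query_tester0_def)
      define acc where "acc = accepts_query (alternating n) A"
      have "\<exists>g. discriminates k \<epsilon> q g"
      proof (rule discriminator_of_tester[OF n R, where k = k and q = q and acc = acc and \<epsilon> = \<epsilon>])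
        fix p assume p: "finite (set_pmf p)" "set_pmf p \<subseteq> range (line_point n)" "card (set_pmf p) \<le> Suc k"
        obtain h where h: "h \<in> tree_class n k" "\<And>x. x \<in> set_pmf p \<Longrightarrow> h x = alternating n x"
          using exists_tree_on_small_support[OF n p(2,1,3)] by blast
        have "class_dist (on_cube n p) (alternating n) (tree_class n k) = 0"
          by (rule class_dist_on_cube_eq_0[OF h])
        then have "prob_at_least (R \<Otimes>\<^sub>M PiM {..<q} (\<lambda>_. on_cube n p)) acc (2/3)"
          using T D[OF p(2)] unfolding query_tester0_def acc_def by blast
        then show "\<exists>acc'. (\<forall>s. \<forall>x\<in>PiE {..<q} (\<lambda>_. set_pmf p). acc' (s, x) = acc (s, x)) \<and>
            prob_at_least (R \<Otimes>\<^sub>M PiM {..<q} (\<lambda>_. on_cube n p)) acc' (2/3)" by blast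
      next
        fix p assume p: "set_pmf p \<subseteq> range (line_point n)"
          "\<epsilon> \<le> class_dist (on_cube n p) (alternating n) (tree_class n k)"
        then show "prob_at_least (R \<Otimes>\<^sub>M PiM {..<q} (\<lambda>_. on_cube n p)) (\<lambda>\<omega>. \<not> acc \<omega>) (2/3)"
          using T D[OF p(1)] unfolding query_tester0_def acc_def by blast
      qed
      then obtain g where "discriminates k \<epsilon> q g" ..
      then show "c * (real k / ln (real k)) \<le> real q" by (rule c(2)[OF k less_imp_le[OF \<epsilon>]])
    qed
  qed
  with c(1) show ?thesis by (intro exI[of _ "1/8192"] exI[of _ c]) auto
qed

end
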